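(* Let $f\ge 1$ be an integer. Let $h(a,q;x)$ be the generating function of generalized Schröder paths with backwards under the line $y=\frac xf$, and let $\psi^{T_{1,f}}(x)$ be the wave function corresponding to the partition function of the colored HOMFLY-PT polynomials of the torus knot $T_{1,f}$ (both defined in the context). Then $$h(a,q;x)=\psi^{T_{1,f}}\big(-\nu^{1/2}q^{f-1}x\big)\Big|_{\nu\to -a^2/q,\ t\to q^{-2}} .$$
   Context: **Paths with backwards.** $\mathbb{N}=\{0,1,2,\dots\}$. For $i,j,l\in\mathbb{N}$, $u_{i,j,l}$ is the number of lattice paths from $(0,0)$ to $(fl,l)$ with left steps $(-1,0)$, right steps $(1,0)$, up steps $(0,1)$ and exactly $\frac i2$ diagonal steps $(1,1)$ such that: each row ends with some (at least one) left steps, or ends at $(fl,l)$; a left step is never followed by a right step, and a right step is never followed by a left step; the path never goes above the line $y=\frac xf$; and the area enclosed by the path and the line $y=\frac xf$ is $\frac j2$. Explicitly, the row condition means: for $l\ge1$, horizontal steps at height $0$ are right steps; at each height $r$ with $1\le r\le l-1$ the path makes at least one left step and no right step; at height $l$ it makes zero or more left steps and no right step, ending at $(fl,l)$. For $l=0$ only the empty path is counted. Set $$h(a,q;x):=\sum_{i,j,l\in\mathbb{N}}u_{i,j,l}\,a^iq^jx^l .$$ **Wave function.** Let $s_\lambda(\mathbf t)$, $\mathbf t=(t_1,t_2,\dots)$, be the Schur polynomials: $\sum_{n\ge0}s_{(n)}(\mathbf t)x^n=\exp(\sum_{k\ge1}t_kx^k)$ (with $s_{(n)}=0$ for $n<0$)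 and $s_\lambda(\mathbf t)=\det(s_{(\lambda_i-i+j)}(\mathbf t))_{1\le i,j\le l(\lambda)}$ for a partition $\lambda$. For relatively prime integers $(m,n)$, the colored HOMFLY-PT polynomial of the torus knot $T_{m,n}$ (with framing $mn$) labeled by a partition $\lambda$ is $$H^{T_{m,n}}_\lambda(\nu,t)=\nu^{n(m-1)|\lambda|/2}\sum_{\mu\vdash m|\lambda|}C^\lambda_{\mu,m}\,t^{-\kappa_\mu n/2m}\,s_\mu(\mathbf t^* ),$$ where $\kappa_\mu=2\sum_{i=1}^{l(\mu)}\sum_{j=1}^{\mu_i}(j-i)$, $s_\mu(\mathbf t^* )$ is the evaluation at $t_i=t_i^*:=\frac1i\cdot\frac{\nu^{i/2}-\nu^{-i/2}}{t^{i/2}-t^{-i/2}}$, and the $C^\lambda_{\mu,m}$ are determined by $s_\lambda(mt_m,mt_{2m},mt_{3m},\dots)=\sum_{\mu\vdash m|\lambda|}C^\lambda_{\mu,m}s_\mu(t_1,t_2,t_3,\dots)$. (For $(m,n)=(1,f)$ this reads $H^{T_{1,f}}_\lambda=t^{-f\kappa_\lambda/2}s_\lambda(\mathbf t^* )$.) The partition function is $Z^{T_{m,n}}(\mathbf t)=\sum_\lambda H^{T_{m,n}}_\lambda(\nu,t)s_\lambda(\mathbf t)$, the sum over all partitions, and the wave function is $$\psi^{T_{m,n}}(x):=\frac{Z^{T_{m,n}}(\mathbf t)|_{t_i=x^i/i}}{Z^{T_{m,n}}(0)}=\sum_{k\ge0}H^{T_{m,n}}_{(k)}(\nu,t)\,x^k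 .$$ **Conventions.** In the substitution $t\to q^{-2}$ one takes $t^{1/2}\to q^{-1}$; after replacing $x$ by $-\nu^{1/2}q^{f-1}x$ only integer powers of $\nu$ occur, so the substitution $\nu\to-a^2/q$ is unambiguous. The identity is one of formal power series in $x$, the coefficients on the right being rational functions of $a,q$ expanded as power series in $q$. *)

theory Defs
  imports "HOL-Analysis.Analysis" "HOL-Computational_Algebra.Computational_Algebra"
    "Jordan_Normal_Form.Determinant"
begin

hide_const (open) Determinants.det Finite_Cartesian_Product.mat

section \<open>Paths with backwards\<close>

datatype step = Left | Right | Up | Diagonal

fun displacement :: "step \<Rightarrow> real \<times> real" where
  "displacement Left = (-1, 0)"
| "displacement Right = (1, 0)"
| "displacement Up = (0, 1)"
| "displacement Diagonal = (1, 1)"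

definition vertex :: "step list \<Rightarrow> nat \<Rightarrow> real \<times> real" where
  "vertex p k = (\<Sum>s\<leftarrow>take k p. displacement s)"

definition path_trace :: "step list \<Rightarrow> (real \<times> real) set" where
  "path_trace p = insert (0, 0) (\<Union>k<length p. closed_segment (vertex p k) (vertex p (Suc k)))"

text \<open>Paths have no downward steps, so the region enclosed by a path that stays weakly below the
  line \<open>y = x / f\<close> and ends on it consists of the points weakly to the right of the line and
  weakly to the left of a point of the path at the same height.\<close>

definition enclosed_region :: "nat \<Rightarrow> step list \<Rightarrow> (real \<times> real) set" where
  "enclosed_region f p =
     {(x, y). real f * y \<le> x \<and> (\<exists>x'. x \<le> x' \<and> (x', y) \<in> path_trace p)}"

definition row_condition :: "nat \<Rightarrow> step list \<Rightarrow> bool" where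
  "row_condition l p \<longleftrightarrow>
     (if l = 0 then p = []
      else (\<forall>k<length p. p ! k = Left \<longrightarrow> snd (vertex p k) \<noteq> 0) \<and>
           (\<forall>k<length p. p ! k = Right \<longrightarrow> snd (vertex p k) = 0) \<and>
           (\<forall>r\<in>{1..<l}. \<exists>k<length p. p ! k = Left \<and> snd (vertex p k) = real r))"

definition backward_path :: "nat \<Rightarrow> nat \<Rightarrow> nat \<Rightarrow> nat \<Rightarrow> step list \<Rightarrow> bool" where
  "backward_path f i j l p \<longleftrightarrow>
     vertex p (length p) = (real (f * l), real l) \<and>
     real (count_list p Diagonal) = real i / 2 \<and>
     row_condition l p \<and>
     (\<forall>k. Suc k < length p \<longrightarrow>
        (p ! k, p ! Suc k) \<noteq> (Left, Right) \<and> (p ! k, p ! Suc k) \<noteq> (Right, Left)) \<and>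
     (\<forall>(x, y)\<in>path_trace p. y \<le> x / real f) \<and>
     measure lborel (enclosed_region f p) = real j / 2"

definition path_count :: "nat \<Rightarrow> nat \<Rightarrow> nat \<Rightarrow> nat \<Rightarrow> nat" where
  "path_count f i j l = card {p. backward_path f i j l p}"

text \<open>The generating function in \<open>\<complex>[[a]][[q]][[x]]\<close>: the outermost variable is \<open>x\<close>, the middle
  one is \<open>q\<close>, the innermost one is \<open>a\<close>.\<close>

definition path_gf :: "nat \<Rightarrow> complex fps fps fps" where
  "path_gf f = Abs_fps (\<lambda>l. Abs_fps (\<lambda>j. Abs_fps (\<lambda>i. of_nat (path_count f i j l))))"


section \<open>Schur polynomials\<close>

definition partitions_of :: "nat \<Rightarrow> nat list set" where
  "partitions_of n = {lam. sorted_wrt (\<ge>) lam \<and> 0 \<notin> set lam \<and> sum_list lam = n}"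

definition partitions :: "nat list set" where
  "partitions = (\<Union>n. partitions_of n)"

text \<open>Polynomials in \<open>t\<^sub>1, t\<^sub>2, \<dots>\<close> are given by their values; the argument \<open>t 0\<close> is not used.\<close>

definition schur_row :: "(nat \<Rightarrow> 'r::{comm_ring_1, inverse, semiring_char_0}) \<Rightarrow> int \<Rightarrow> 'r" where
  "schur_row t n =
     (if n < 0 then 0
      else fps_nth (fps_exp 1 oo Abs_fps (\<lambda>k. if k = 0 then 0 else t k)) (nat n))"

definition schur :: "nat list \<Rightarrow> (nat \<Rightarrow> 'r::{comm_ring_1, inverse, semiring_char_0}) \<Rightarrow> 'r" where
  "schur lam t =
     det (Matrix.mat (length lam) (length lam) (\<lambda>(i, j). schur_row t (int (lam ! i) - int i + int j)))"


section \<open>Colored HOMFLY-PT polynomials of torus knots and the wave function\<close>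

definition kappa :: "nat list \<Rightarrow> int" where
  "kappa \<mu> = 2 * (\<Sum>i = 1..length \<mu>. \<Sum>j = 1..\<mu> ! (i - 1). int j - int i)"

text \<open>An identity of polynomials over \<open>\<rat>\<close> is the same as an identity of their values at all
  rational points; the coefficients are unique because the Schur polynomials of the partitions of
  a given number are linearly independent.\<close>

definition adams_coeff :: "nat \<Rightarrow> nat list \<Rightarrow> nat list \<Rightarrow> rat" where
  "adams_coeff m lam =
     (THE C. (\<forall>\<mu>. \<mu> \<notin> partitions_of (m * sum_list lam) \<longrightarrow> C \<mu> = 0) \<and>
        (\<forall>t :: nat \<Rightarrow> rat. schur lam (\<lambda>k. of_nat m * t (m * k)) =
           (\<Sum>\<mu>\<in>partitions_of (m * sum_list lam). C \<mu> * schur \<mu> t)))"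

definition t_star :: "'k::field_char_0 \<Rightarrow> 'k \<Rightarrow> nat \<Rightarrow> 'k" where
  "t_star nu_half t_half i =
     1 / of_nat i * ((nu_half ^ i - inverse nu_half ^ i) / (t_half ^ i - inverse t_half ^ i))"

text \<open>The half-integral powers of \<open>\<nu>\<close> and the fractional powers of \<open>t\<close> are expressed through
  \<open>nu_half = \<nu>^(1/2)\<close> and \<open>tau = t^(1/(2m))\<close>, so that \<open>t^(1/2)\<close> is \<open>tau ^ m\<close> and
  \<open>t^(-\<kappa> n/(2m))\<close> is \<open>tau powi (- \<kappa> * n)\<close>. For \<open>m = 1\<close>, \<open>tau = t^(1/2)\<close>.\<close>

definition homfly_torus :: "nat \<Rightarrow> int \<Rightarrow> 'k::field_char_0 \<Rightarrow> 'k \<Rightarrow> nat list \<Rightarrow> 'k" where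
  "homfly_torus m n nu_half tau lam =
     nu_half powi (n * (int m - 1) * int (sum_list lam)) *
     (\<Sum>\<mu>\<in>partitions_of (m * sum_list lam).
        of_rat (adams_coeff m lam \<mu>) * tau powi (- kappa \<mu> * n) *
        schur \<mu> (t_star nu_half (tau ^ m)))"

text \<open>The partition function at \<open>t\<close>, where each \<open>t k\<close> is a formal power series in \<open>x\<close>; the sum
  over all partitions is taken in the \<open>x\<close>-adic topology.\<close>

definition partition_function ::
    "nat \<Rightarrow> int \<Rightarrow> 'k::field_char_0 \<Rightarrow> 'k \<Rightarrow> (nat \<Rightarrow> 'k fps) \<Rightarrow> 'k fps" where
  "partition_function m n nu_half tau t =
     (\<Sum>\<^sub>\<infinity>lam\<in>partitions. fps_const (homfly_torus m n nu_half tau lam) * schur lam t)"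

definition wave_function :: "nat \<Rightarrow> int \<Rightarrow> 'k::field_char_0 \<Rightarrow> 'k \<Rightarrow> 'k fps" where
  "wave_function m n nu_half tau =
     partition_function m n nu_half tau (\<lambda>i. fps_X ^ i / of_nat i) /
     partition_function m n nu_half tau (\<lambda>_. 0)"


section \<open>The common coefficient field\<close>

text \<open>After \<open>\<nu> \<rightarrow> - a\<^sup>2 / q\<close>, the individual factors of the wave function involve
  \<open>\<nu>^(1/2)\<close>, hence \<open>\<i>\<close> and \<open>q^(1/2)\<close>. Both sides are therefore compared in
  \<open>\<complex>((a))((q^(1/2)))[[x]]\<close>; the outer Laurent variable is \<open>q^(1/2)\<close>, the inner one
  is \<open>a\<close>.\<close>

definition var_a :: "complex fls fls" where
  "var_a = fls_const fls_X"

definition var_q :: "complex fls fls" where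
  "var_q = fls_X ^ 2"

definition embed :: "complex fps fps fps \<Rightarrow> complex fls fls fps" where
  "embed F =
     Abs_fps (\<lambda>l. fls_compose_power
       (fps_to_fls (Abs_fps (\<lambda>j. fps_to_fls (fps_nth (fps_nth F l) j)))) 2)"

lemma ex_sqrt_nu: "\<exists>w :: complex fls fls. w ^ 2 = - (var_a ^ 2) / var_q"
proof
  have "(fls_const (fls_const \<i>) :: complex fls fls) ^ 2 = -1"
    by (simp add: power2_eq_square)
  then show "(fls_const (fls_const \<i>) * var_a / fls_X) ^ 2 = - (var_a ^ 2) / var_q"
    unfolding var_q_def by (simp only: power_divide power_mult_distrib) simp
qed

end

theory Submission
  imports Defs
begin

text \<open>Both sides have explicit coefficients: with \<open>q\<close> for \<open>var_q\<close> and \<open>a\<close> for \<open>var_a\<close>, the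
  coefficient of \<open>x ^ l\<close> is the product of \<open>q ^ (f * l\<^sup>2 - l)\<close> and of the factors
  \<open>(a\<^sup>2 + q ^ (2 * s + 1)) / (1 - q ^ (2 * s + 2))\<close> for \<open>s < l\<close>. The two evaluations meet in a
  first-order recursion in \<open>l\<close>.

  On the path side, the row condition forces a path to consist of \<open>b\<close> right steps followed by
  \<open>l\<close> rows, each an up or diagonal step and then \<open>n\<close> left steps. The end point determines \<open>b\<close>.
  Staying below the line is then automatic: after the right steps the quantity \<open>x - f * y\<close> never
  increases (this uses \<open>f \<ge> 1\<close>), and it ends at \<open>0\<close>. By Fubini, twice the area is \<open>f * l\<^sup>2\<close> plus
  \<open>2 * (s + 1)\<close> for each left step of row \<open>s\<close> and minus \<open>2 * s + 1\<close> for its diagonal step, if it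
  has one (\<open>backward_path_iff\<close>). So the rows contribute independently: after removal of the one
  compulsory left step of every row but the last, row \<open>s\<close> contributes the factor displayed above
  (\<open>codes_gf_Suc\<close>, \<open>path_gf_nth\<close>).

  For the wave function, \<open>m = 1\<close> makes the plethysm trivial, so that its coefficients are
  Kronecker deltas; this is where the linear independence of the Schur polynomials enters, as
  the coefficients are characterised by an expansion (\<open>adams_coeff_one\<close>). At \<open>t\<^sub>i = x ^ i / i\<close>
  the complete homogeneous functions are the powers of \<open>x\<close>, two rows of a Jacobi-Trudi matrix
  become proportional, and only one-row partitions survive (\<open>wave_function_one\<close>). What remains
  are the values \<open>e\<^sub>k\<close> of the complete homogeneous functions at \<open>t_star\<close>. Their generating
  function \<open>E\<close> satisfies \<open>E (T * x) * (1 - N * x) = E (x / T) * (1 - x / N)\<close> with \<open>N\<^sup>2 = \<nu>\<close> and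
  \<open>T\<^sup>2 = t\<close>, because both sides solve the same linear differential equation; comparing
  coefficients gives the recursion for \<open>e\<^sub>k\<close> (\<open>schur_row_t_star_rec\<close>). The substitution
  \<open>T = 1 / q\<close>, \<open>N\<^sup>2 = - a\<^sup>2 / q\<close> turns it into the recursion of the paths (\<open>embed_codes_gf\<close>).\<close>

section \<open>Complete homogeneous functions and linear differential equations\<close>

lemma fps_linear_ode_unique:
  fixes F G M :: "'a::{idom, semiring_char_0} fps"
  assumes "fps_deriv F = M * F" "fps_deriv G = M * G" "fps_nth F 0 = fps_nth G 0"
  shows "F = G"
proof (rule fps_ext)
  fix n show "fps_nth F n = fps_nth G n"
  proof (induction n rule: less_induct)
    case (less n)
    show ?case
    proof (cases n)
      case 0
      then show ?thesis using assms(3) by simp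
    next
      case (Suc m)
      have F: "of_nat (Suc m) * fps_nth F (Suc m) = (\<Sum>i=0..m. fps_nth M i * fps_nth F (m - i))"
        using arg_cong[OF assms(1), of "\<lambda>H. fps_nth H m"] by (simp add: fps_mult_nth)
      have G: "of_nat (Suc m) * fps_nth G (Suc m) = (\<Sum>i=0..m. fps_nth M i * fps_nth G (m - i))"
        using arg_cong[OF assms(2), of "\<lambda>H. fps_nth H m"] by (simp add: fps_mult_nth)
      have "of_nat (Suc m) * fps_nth F (Suc m) = of_nat (Suc m) * fps_nth G (Suc m)"
        unfolding F G by (intro sum.cong refl arg_cong2[where f = "(*)"] less.IH) (auto simp: Suc)
      then show ?thesis
        using Suc by (simp del: of_nat_Suc)
    qed
  qed
qed

text \<open>Schur polynomials are also evaluated in the ring of formal power series, where \<open>fps_exp\<close>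
  lives over a ring that is not a field. The exponential still has the expected derivative as
  soon as factorials are invertible, which is the first hypothesis.\<close>

lemma fps_deriv_exp_compose:
  fixes A :: "'r::{idom, inverse, semiring_char_0} fps"
  assumes fact: "\<And>n. of_nat (fact n) * (1 / of_nat (fact n)) = (1 :: 'r)"
    and "fps_nth A 0 = 0"
  shows "fps_deriv (fps_exp 1 oo A) = fps_deriv A * (fps_exp 1 oo A)"
    and "fps_nth (fps_exp 1 oo A) 0 = 1"
proof -
  have "of_nat (Suc n) * (1 / of_nat (fact (Suc n))) = (1 / of_nat (fact n) :: 'r)" for n
  proof -
    have "of_nat (fact n) * (of_nat (Suc n) * (1 / of_nat (fact (Suc n)))) = (1 :: 'r)"
      using fact[of "Suc n"] by (simp only: fact_Suc of_nat_mult of_nat_id mult_ac)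
    also have "\<dots> = of_nat (fact n) * (1 / of_nat (fact n))"
      by (simp only: fact)
    finally show ?thesis
      by (subst (asm) mult_cancel_left) (auto simp del: of_nat_Suc of_nat_fact)
  qed
  then have "fps_deriv (fps_exp 1 :: 'r fps) = fps_exp 1"
    by (intro fps_ext) (simp only: fps_deriv_nth fps_exp_nth power_one Suc_eq_plus1[symmetric])
  then show "fps_deriv (fps_exp 1 oo A) = fps_deriv A * (fps_exp 1 oo A)"
    using fps_compose_deriv[OF assms(2), of "fps_exp 1"] by (simp add: mult.commute)
  show "fps_nth (fps_exp 1 oo A) 0 = 1"
    using fact[of 0] by simp
qed

text \<open>The generating function \<open>exp (\<Sum>k. t k * y ^ k)\<close> of the \<open>schur_row t n\<close> is characterised by
  its logarithmic derivative; this replaces every direct manipulation of the exponential.\<close>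

lemma schur_row_eqI:
  fixes t :: "nat \<Rightarrow> 'r::{idom, inverse, semiring_char_0}"
  assumes fact: "\<And>n. of_nat (fact n) * (1 / of_nat (fact n)) = (1 :: 'r)"
    and "fps_deriv G = fps_deriv (Abs_fps (\<lambda>k. if k = 0 then 0 else t k)) * G"
    and "fps_nth G 0 = 1"
  shows "schur_row t (int n) = fps_nth G n"
proof -
  have "fps_exp 1 oo Abs_fps (\<lambda>k. if k = 0 then 0 else t k) = G"
    by (rule fps_linear_ode_unique[OF fps_deriv_exp_compose(1)[OF fact] assms(2)
          trans[OF fps_deriv_exp_compose(2)[OF fact] assms(3)[symmetric]]]) simp_all
  then show ?thesis
    by (simp add: schur_row_def)
qed

lemma fps_of_nat_fact_mult_inverse:
  "of_nat (fact n) * (1 / of_nat (fact n)) = (1 :: 'k::field_char_0 fps)"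
  by (metis fact_nonzero fps_nth_of_nat inverse_mult_eq_1' fps_divide_unit mult_1
      of_nat_eq_0_iff)

text \<open>At \<open>t i = x ^ i / i\<close> the generating function is
  \<open>exp (- log (1 - x * y)) = 1 / (1 - x * y)\<close>.\<close>

lemma schur_row_geometric:
  "schur_row (\<lambda>i. fps_X ^ i / of_nat i) (int n) = (fps_X ^ n :: 'k::field_char_0 fps)"
proof -
  have t: "of_nat (Suc i) * (x / of_nat (Suc i)) = x" for x :: "'k fps" and i
    by (metis (no_types, lifting) fps_divide_unit fps_nth_of_nat inverse_mult_eq_1' mult.assoc
        mult.commute mult.right_neutral of_nat_eq_0_iff nat.distinct(1))
  have "fps_deriv (Abs_fps (\<lambda>m. fps_X ^ m)) =
    fps_deriv (Abs_fps (\<lambda>k. if k = 0 then 0 else fps_X ^ k / of_nat k)) *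
      Abs_fps (\<lambda>m. fps_X ^ m :: 'k fps)"
  proof (rule fps_ext)
    fix m
    have "fps_nth (fps_deriv (Abs_fps (\<lambda>k. if k = 0 then 0 else fps_X ^ k / of_nat k)) *
        Abs_fps (\<lambda>m. fps_X ^ m :: 'k fps)) m = (\<Sum>i=0..m. fps_X ^ Suc i * fps_X ^ (m - i))"
      unfolding fps_mult_nth
      by (intro sum.cong refl) (simp only: fps_deriv_nth fps_nth_Abs_fps t Suc_eq_plus1[symmetric]
        nat.distinct if_False)
    also have "\<dots> = (\<Sum>i=0..m. fps_X ^ Suc m)"
      by (intro sum.cong refl) (simp flip: power_add)
    finally show "fps_nth (fps_deriv (Abs_fps (\<lambda>m. fps_X ^ m))) m =
      fps_nth (fps_deriv (Abs_fps (\<lambda>k. if k = 0 then 0 else fps_X ^ k / of_nat k)) *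
        Abs_fps (\<lambda>m. fps_X ^ m :: 'k fps)) m"
      by simp
  qed
  from schur_row_eqI[OF fps_of_nat_fact_mult_inverse this, of n] show ?thesis by simp
qed

lemma schur_row_zero: "schur_row (\<lambda>_. 0 :: 'k::field_char_0 fps) (int n) = (if n = 0 then 1 else 0)"
proof -
  have "Abs_fps (\<lambda>k. if k = 0 then 0 else 0) = (0 :: 'k fps fps)"
    by (rule fps_ext) simp
  then have "schur_row (\<lambda>_. 0 :: 'k fps) (int n) = fps_nth 1 n"
    by (intro schur_row_eqI[OF fps_of_nat_fact_mult_inverse]) simp_all
  then show ?thesis
    by simp
qed

text \<open>The complete homogeneous functions can take arbitrary values \<open>h n\<close> with \<open>h 0 = 1\<close>: the
  required \<open>t\<close> is the formal logarithm of the generating function of \<open>h\<close>, obtained by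
  integrating its logarithmic derivative.\<close>

lemma ex_schur_row_eq:
  fixes h :: "nat \<Rightarrow> 'k::field_char_0"
  assumes "h 0 = 1"
  shows "\<exists>t. \<forall>n. schur_row t (int n) = h n"
proof -
  define H where "H = Abs_fps h"
  define t where "t = fps_nth (fps_integral0 (fps_deriv H * inverse H))"
  have "Abs_fps (\<lambda>k. if k = 0 then 0 else t k) = fps_integral0 (fps_deriv H * inverse H)"
    by (rule fps_ext) (simp add: t_def fps_integral_def)
  moreover have "inverse H * H = 1"
    by (rule inverse_mult_eq_1) (simp add: H_def assms)
  ultimately have "fps_deriv H = fps_deriv (Abs_fps (\<lambda>k. if k = 0 then 0 else t k)) * H"
    by (simp add: fps_deriv_fps_integral mult.assoc)
  then have "schur_row t (int n) = fps_nth H n" for n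
    by (rule schur_row_eqI[rotated]) (simp_all add: H_def assms)
  then show ?thesis
    by (auto simp: H_def)
qed

text \<open>A \<open>q\<close>-binomial theorem. The definition of \<open>t_star\<close> gives
  \<open>i * t_star N T i * (T ^ i - T ^ (- i)) = N ^ i - N ^ (- i)\<close>, which says that the logarithmic
  derivatives of \<open>E (T * x) * (1 - N * x)\<close> and \<open>E (x / T) * (1 - x / N)\<close> agree, for the
  generating function \<open>E\<close> of the \<open>schur_row\<close>. Hence these two series are equal, and the
  recursion is the equality of their coefficients.\<close>

lemma schur_row_t_star_rec:
  fixes N T :: "'k::field_char_0"
  assumes T: "\<And>i. i > 0 \<Longrightarrow> T ^ i \<noteq> inverse T ^ i"
  shows "(T ^ Suc k - inverse T ^ Suc k) * schur_row (t_star N T) (int (Suc k)) =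
    (N * T ^ k - inverse N * inverse T ^ k) * schur_row (t_star N T) (int k)"
proof -
  define A where "A = Abs_fps (\<lambda>k. if k = 0 then 0 else t_star N T k)"
  define E where "E = fps_exp 1 oo A"
  define geo where "geo c = Abs_fps (\<lambda>n. c ^ n)" for c :: 'k
  define dil where "dil F c = F oo (fps_const c * fps_X)" for F :: "'k fps" and c
  \<comment> \<open>\<open>M\<close> is the common logarithmic derivative; \<open>geo c\<close> is \<open>1 / (1 - c * x)\<close>, and \<open>dil F c\<close> is
    \<open>F (c * x)\<close>.\<close>
  define M where "M = fps_const T * dil (fps_deriv A) T - fps_const N * geo N"
  have dil_nth: "fps_nth (dil F c) n = c ^ n * fps_nth F n" for F c n
    by (simp add: dil_def fps_compose_linear)
  have E: "fps_deriv E = fps_deriv A * E" "fps_nth E 0 = 1"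
    unfolding E_def by (rule fps_deriv_exp_compose; simp add: A_def)+
  have geo: "geo c * (1 - fps_const c * fps_X) = 1" for c
  proof -
    have "geo c = 1 + fps_const c * fps_X * geo c"
    proof (rule fps_ext)
      fix n show "fps_nth (geo c) n = fps_nth (1 + fps_const c * fps_X * geo c) n"
        by (cases n) (simp_all add: geo_def mult.assoc)
    qed
    then show ?thesis
      by (simp add: algebra_simps)
  qed
  have deriv: "fps_deriv (dil E c * (1 - fps_const d * fps_X)) =
      (fps_const c * dil (fps_deriv A) c - fps_const d * geo d) * (dil E c * (1 -
        fps_const d * fps_X))"
    for c d
  proof -
    have "fps_deriv (dil E c) = dil (fps_deriv A * E) c * fps_const c"
      unfolding dil_def by (subst fps_compose_deriv) (simp_all add: E)
    also have "\<dots> = fps_const c * dil (fps_deriv A) c * dil E c"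
      unfolding dil_def by (subst fps_compose_mult_distrib) (simp_all add: mult_ac)
    finally have "fps_deriv (dil E c * (1 - fps_const d * fps_X)) =
        fps_const c * dil (fps_deriv A) c * dil E c * (1 - fps_const d * fps_X) -
        fps_const d * dil E c * (geo d * (1 - fps_const d * fps_X))"
      by (simp only: geo) (simp add: algebra_simps)
    also have "\<dots> = (fps_const c * dil (fps_deriv A) c - fps_const d * geo d) * (dil E c * (1 -
      fps_const d * fps_X))"
      by (simp only: algebra_simps)
    finally show ?thesis .
  qed
  have M: "M = fps_const (inverse T) * dil (fps_deriv A) (inverse T) -
    fps_const (inverse N) * geo (inverse N)"
  proof (rule fps_ext)
    fix n
    have "of_nat (Suc n) * t_star N T (Suc n) * (T ^ Suc n - inverse T ^ Suc n) =
      N ^ Suc n - inverse N ^ Suc n"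
      using T[of "Suc n"] unfolding t_star_def by (simp del: power_Suc of_nat_Suc)
    then show "fps_nth M n = fps_nth (fps_const (inverse T) * dil (fps_deriv A) (inverse T) -
      fps_const (inverse N) * geo (inverse N)) n"
      unfolding M_def fps_sub_nth fps_mult_left_const_nth dil_nth
        by (simp add: A_def geo_def algebra_simps)
  qed
  have "dil E T * (1 - fps_const N * fps_X) =
    dil E (inverse T) * (1 - fps_const (inverse N) * fps_X)"
    by (rule fps_linear_ode_unique[OF deriv[of T N, folded M_def]
          deriv[of "inverse T" "inverse N", folded M]]) (simp add: dil_nth E)
  from arg_cong[OF this, of "\<lambda>F. fps_nth F (Suc k)"]
  have "T ^ Suc k * fps_nth E (Suc k) - N * (T ^ k * fps_nth E k) =
    inverse T ^ Suc k * fps_nth E (Suc k) - inverse N * (inverse T ^ k * fps_nth E k)"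
    by (simp add: dil_nth right_diff_distrib mult.commute[of _ "fps_const _ * fps_X"] mult.assoc)
  moreover have "schur_row (t_star N T) (int n) = fps_nth E n" for n
    by (simp add: schur_row_def E_def A_def)
  ultimately show ?thesis
    by (simp only: algebra_simps)
qed


section \<open>Linear independence of Schur polynomials\<close>

text \<open>The Schur polynomials are separated by the substitution of a large power \<open>z ^ B ^ n\<close> for
  the \<open>n\<close>-th complete homogeneous function, \<open>n > 0\<close>. The diagonal of the Jacobi-Trudi
  determinant of \<open>mu\<close> then contributes the exponent \<open>lex_rank B mu\<close>, in which the parts act as
  digit positions in base \<open>B\<close>; every other permutation contributes \<open>0\<close> or a larger exponent.\<close>

definition lex_rank :: "nat \<Rightarrow> nat list \<Rightarrow> nat" where
  "lex_rank B mu = (\<Sum>m\<leftarrow>mu. B ^ m)"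

lemma sum_list_map_le:
  fixes c :: nat
  assumes "\<And>x. x \<in> set xs \<Longrightarrow> f x \<le> c"
  shows "(\<Sum>x\<leftarrow>xs. f x) \<le> length xs * c"
  using sum_list_mono[of xs f "\<lambda>_. c"] assms by (simp add: sum_list_triv)

lemma lex_rank_less:
  assumes "length xs < B" "\<And>x. x \<in> set xs \<Longrightarrow> x \<le> m" "m < y"
  shows "lex_rank B xs < B ^ y"
proof -
  have "lex_rank B xs \<le> length xs * B ^ m"
    unfolding lex_rank_def using assms by (intro sum_list_map_le power_increasing) auto
  also have "\<dots> < B ^ Suc m"
    using assms(1) by simp
  also have "\<dots> \<le> B ^ y"
    using assms by (intro power_increasing) auto
  finally show ?thesis .
qed

text \<open>If the first parts differ, the partition with the larger one has the larger rank: by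
  \<open>lex_rank_less\<close> fewer than \<open>B\<close> smaller digits cannot compensate for it.\<close>

lemma lex_rank_inject:
  assumes "sorted_wrt (\<ge>) xs" "sorted_wrt (\<ge>) ys" "length xs < B" "length ys < B"
    and "lex_rank B xs = lex_rank B ys"
  shows "xs = ys"
  using assms
proof (induction xs arbitrary: ys)
  case Nil
  then show ?case
    by (cases ys) (auto simp: lex_rank_def)
next
  case (Cons x xs)
  have "B > 0"
    using Cons.prems by simp
  then obtain y ys' where ys: "ys = y # ys'"
    using Cons.prems by (cases ys) (auto simp: lex_rank_def)
  have "\<not> x < y"
    using lex_rank_less[of "x # xs" B x y] Cons.prems by (auto simp: ys lex_rank_def)
  moreover have "\<not> y < x"
    using lex_rank_less[of "y # ys'" B y x] Cons.prems by (auto simp: ys lex_rank_def)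
  ultimately show ?case
    using Cons.IH[of ys'] Cons.prems by (simp add: ys lex_rank_def)
qed

text \<open>The exponent of \<open>z\<close> in place of the \<open>m\<close>-th complete homogeneous function. It is \<open>0\<close> rather
  than \<open>B ^ 0\<close> for \<open>m = 0\<close>, since the \<open>0\<close>-th one is \<open>1\<close>.\<close>

definition lex_weight :: "nat \<Rightarrow> nat \<Rightarrow> nat" where
  "lex_weight B m = (if m = 0 then 0 else B ^ m)"

definition jt_weight :: "nat \<Rightarrow> nat list \<Rightarrow> (nat \<Rightarrow> nat) \<Rightarrow> nat" where
  "jt_weight B mu p = (\<Sum>i = 0..<length mu. lex_weight B (mu ! i + p i - i))"

lemma lex_rank_conv_jt_weight:
  assumes "0 \<notin> set mu"
  shows "lex_rank B mu = jt_weight B mu id"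
proof -
  have "mu ! i \<noteq> 0" if "i < length mu" for i
    using assms that by (metis nth_mem)
  then show ?thesis
    by (auto simp: lex_rank_def jt_weight_def sum_list_sum_nth lex_weight_def intro!: sum.cong)
qed

text \<open>At the first index \<open>k\<close> moved by \<open>p\<close> we have \<open>p k > k\<close>. The corresponding entry alone adds
  at least \<open>B ^ (mu ! k + 1)\<close> to the exponent, more than all the diagonal entries from row \<open>k\<close>
  on together.\<close>

lemma lex_rank_less_jt_weight:
  assumes mu: "sorted_wrt (\<ge>) mu" "0 \<notin> set mu" "length mu < B"
    and p: "p permutes {0..<length mu}" "p \<noteq> id"
  shows "lex_rank B mu < jt_weight B mu p"
proof -
  let ?l = "length mu"
  define k where "k = (LEAST i. p i \<noteq> i)"
  have "\<exists>i. p i \<noteq> i"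
    using p(2) by auto
  then have "p k \<noteq> k"
    unfolding k_def by (rule LeastI_ex)
  have below: "p i = i" if "i < k" for i
    using not_less_Least that unfolding k_def by blast
  have "k < ?l"
    using \<open>p k \<noteq> k\<close> permutes_not_in[OF p(1), of k] by fastforce
  have "\<not> p k < k"
    using below \<open>p k \<noteq> k\<close> permutes_inj[OF p(1)] by (metis injD)
  with \<open>p k \<noteq> k\<close> have "k < p k"
    by simp
  have "(\<Sum>i = k..<?l. B ^ (mu ! i)) \<le> (\<Sum>i = k..<?l. B ^ (mu ! k))"
  proof (intro sum_mono power_increasing)
    fix i assume "i \<in> {k..<?l}"
    then show "mu ! i \<le> mu ! k"
      using mu(1) by (cases "i = k") (auto simp: sorted_wrt_iff_nth_less)
  qed (use mu in auto)
  also have "\<dots> < B ^ Suc (mu ! k)"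
    using mu(3) by auto
  also have "\<dots> \<le> lex_weight B (mu ! k + p k - k)"
    using \<open>k < p k\<close> mu(3) unfolding lex_weight_def
      by (auto intro!: power_increasing simp del: power_Suc)
  also have "\<dots> \<le> (\<Sum>i = k..<?l. lex_weight B (mu ! i + p i - i))"
    using \<open>k < ?l\<close> by (intro member_le_sum) auto
  finally have "(\<Sum>i = k..<?l. B ^ (mu ! i)) < (\<Sum>i = k..<?l. lex_weight B (mu ! i + p i - i))" .
  moreover have "(\<Sum>i = 0..<k. B ^ (mu ! i)) = (\<Sum>i = 0..<k. lex_weight B (mu ! i + p i - i))"
  proof (intro sum.cong refl)
    fix i assume "i \<in> {0..<k}"
    then have "mu ! i \<noteq> 0" "p i = i"
      using \<open>k < ?l\<close> mu(2) below by (auto simp: in_set_conv_nth)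
    then show "B ^ (mu ! i) = lex_weight B (mu ! i + p i - i)"
      by (simp add: lex_weight_def)
  qed
  moreover have "sum g {0..<?l} = sum g {0..<k} + sum g {k..<?l}" for g :: "nat \<Rightarrow> nat"
    using \<open>k < ?l\<close> by (simp add: sum.atLeastLessThan_concat)
  ultimately show ?thesis
    by (simp add: lex_rank_def jt_weight_def sum_list_sum_nth)
qed

definition jt_poly :: "nat \<Rightarrow> nat list \<Rightarrow> rat poly" where
  "jt_poly B mu = (\<Sum>p | p permutes {0..<length mu}.
     Polynomial.smult (signof p) (if \<forall>i<length mu. i \<le> mu ! i +
       p i then monom 1 (jt_weight B mu p) else 0))"

lemma poly_jt_poly:
  assumes t: "\<And>n. schur_row t (int n) = z ^ lex_weight B n"
  shows "poly (jt_poly B mu) z = schur mu t"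
proof -
  let ?l = "length mu"
  let ?A = "Matrix.mat ?l ?l (\<lambda>(i, j). schur_row t (int (mu ! i) - int i + int j))"
  have entry: "schur_row t (int a - int i + int j) =
    (if i \<le> a + j then z ^ lex_weight B (a + j - i) else 0)"
    for a i j
  proof (cases "i \<le> a + j")
    case True
    then have "int a - int i + int j = int (a + j - i)"
      by simp
    then show ?thesis
      using True by (simp only: t) simp
  next
    case False
    then show ?thesis
      by (simp add: schur_row_def)
  qed
  have "schur mu t = (\<Sum>p | p permutes {0..<?l}. signof p * (\<Prod>i = 0..<?l. ?A $$ (i, p i)))"
    unfolding schur_def by (rule det_def'[OF mat_carrier])
  also have "\<dots> = (\<Sum>p | p permutes {0..<?l}. signof p *
      (if \<forall>i<?l. i \<le> mu ! i + p i then z ^ jt_weight B mu p else 0))"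
  proof (intro sum.cong refl arg_cong2[where f = "(*)"])
    fix p assume "p \<in> {p. p permutes {0..<?l}}"
    then have "(\<Prod>i = 0..<?l. ?A $$ (i, p i)) =
        (\<Prod>i = 0..<?l. if i \<le> mu ! i + p i then z ^ lex_weight B (mu ! i + p i - i) else 0)"
      using permutes_in_image[of p "{0..<?l}"] by (intro prod.cong) (auto simp: entry)
    also have "\<dots> = (if \<forall>i<?l. i \<le> mu ! i + p i then z ^ jt_weight B mu p else 0)"
    proof (cases "\<forall>i<?l. i \<le> mu ! i + p i")
      case True
      then show ?thesis
        by (auto simp: jt_weight_def power_sum intro!: prod.cong)
    next
      case False
      then show ?thesis
        by (auto intro!: prod_zero)
    qed
    finally show "(\<Prod>i = 0..<?l. ?A $$ (i, p i)) = \<dots>" .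
  qed
  also have "\<dots> = poly (jt_poly B mu) z"
    unfolding jt_poly_def poly_sum by (intro sum.cong refl) (auto simp: poly_monom)
  finally show ?thesis ..
qed

lemma coeff_jt_poly:
  assumes mu: "sorted_wrt (\<ge>) mu" "0 \<notin> set mu" "length mu < B"
    and "k \<le> lex_rank B mu"
  shows "coeff (jt_poly B mu) k = (if k = lex_rank B mu then 1 else 0)"
proof -
  let ?l = "length mu"
  have "coeff (jt_poly B mu) k = (\<Sum>p | p permutes {0..<?l}.
    if p = id then (if k = lex_rank B mu then 1 else 0) else 0)"
    unfolding jt_poly_def coeff_sum
  proof (intro sum.cong refl)
    fix p assume "p \<in> {p. p permutes {0..<?l}}"
    then show "coeff (Polynomial.smult (signof p) (if \<forall>i<?l. i \<le> mu ! i +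
      p i then monom 1 (jt_weight B mu p) else 0)) k =
        (if p = id then (if k = lex_rank B mu then 1 else 0) else 0)"
      using lex_rank_less_jt_weight[OF mu, of p] lex_rank_conv_jt_weight[OF mu(2), of B] assms(4)
      by (auto simp: coeff_monom)
  qed
  also have "\<dots> = (if k = lex_rank B mu then 1 else 0)"
    by (subst sum.delta) (auto simp: finite_permutations permutes_id)
  finally show ?thesis .
qed

lemma length_partition_le:
  assumes "mu \<in> partitions_of n"
  shows "length mu \<le> n"
proof -
  have "length mu \<le> sum_list mu" if "0 \<notin> set mu" for mu :: "nat list"
    using that by (induction mu) auto
  with assms show ?thesis
    by (auto simp: partitions_of_def)
qed

lemma finite_partitions_of: "finite (partitions_of n)"
proof (rule finite_subset)
  show "partitions_of n \<subseteq> {xs. set xs \<subseteq> {..n} \<and> length xs \<le> n}"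
    using length_partition_le by (auto simp: partitions_of_def member_le_sum_list)
qed (simp add: finite_lists_length_le)

text \<open>In a vanishing linear combination, take a partition of least rank among those with a
  nonzero coefficient. After the substitution described above the combination is a polynomial in
  \<open>z\<close> that vanishes everywhere, but its coefficient at that least rank is the chosen
  coefficient.\<close>

lemma schur_linear_independent:
  fixes c :: "nat list \<Rightarrow> rat"
  assumes "\<And>t. (\<Sum>mu\<in>partitions_of n. c mu * schur mu t) = 0" "mu \<in> partitions_of n"
  shows "c mu = 0"
proof (rule ccontr)
  assume "c mu \<noteq> 0"
  define B where "B = Suc n"
  define S where "S = {mu \<in> partitions_of n. c mu \<noteq> 0}"
  have S: "sorted_wrt (\<ge>) mu" "0 \<notin> set mu" "length mu < B" if "mu \<in> partitions_of n" for mu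
    using that length_partition_le[OF that] by (auto simp: partitions_of_def B_def)
  have "finite S" "S \<noteq> {}"
    using \<open>c mu \<noteq> 0\<close> assms(2) finite_partitions_of by (auto simp: S_def)
  then obtain nu where nu: "nu \<in> S" and min: "\<And>mu. mu \<in> S \<Longrightarrow> lex_rank B nu \<le> lex_rank B mu"
    using arg_min_if_finite[of S "lex_rank B"] by (meson not_le)
  define P where "P = (\<Sum>mu\<in>partitions_of n. Polynomial.smult (c mu) (jt_poly B mu))"
  have "poly P z = 0" for z
  proof -
    obtain t where t: "\<And>n. schur_row t (int n) = z ^ lex_weight B n"
      using ex_schur_row_eq[of "\<lambda>n. z ^ lex_weight B n"] by (auto simp: lex_weight_def)
    have "poly P z = (\<Sum>mu\<in>partitions_of n. c mu * schur mu t)"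
      by (simp add: P_def poly_sum poly_jt_poly[OF t])
    then show ?thesis
      using assms(1) by simp
  qed
  then have "P = 0"
    using poly_all_0_iff_0 by blast
  then have "0 = coeff P (lex_rank B nu)"
    by simp
  also have "\<dots> = (\<Sum>mu\<in>partitions_of n. if mu = nu then c nu else 0)"
    unfolding P_def coeff_sum
  proof (intro sum.cong refl)
    fix mu assume mu: "mu \<in> partitions_of n"
    have "lex_rank B nu = lex_rank B mu \<longleftrightarrow> mu = nu"
      using lex_rank_inject[of mu nu B] S mu nu by (auto simp: S_def)
    then show "coeff (Polynomial.smult (c mu) (jt_poly B mu)) (lex_rank B nu) = (if mu =
      nu then c nu else 0)"
      using coeff_jt_poly[OF S[OF mu], of "lex_rank B nu"] min[of mu] mu
      by (cases "c mu = 0") (auto simp: S_def)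
  qed
  also have "\<dots> = c nu"
    using nu by (simp add: S_def finite_partitions_of)
  finally show False
    using nu by (simp add: S_def)
qed

text \<open>For \<open>m = 1\<close> the indicator function of \<open>lam\<close> is a possible coefficient function; linear
  independence makes it the only one, as required by the definite description.\<close>

lemma adams_coeff_one:
  assumes "lam \<in> partitions_of n"
  shows "adams_coeff 1 lam = (\<lambda>mu. if mu = lam then 1 else 0)"
proof -
  have n: "sum_list lam = n"
    using assms by (simp add: partitions_of_def)
  show ?thesis
    unfolding adams_coeff_def n mult_1
  proof (intro the_equality conjI allI impI)
    fix t :: "nat \<Rightarrow> rat"
    show "schur lam (\<lambda>k. of_nat 1 * t k) = (\<Sum>\<mu>\<in>partitions_of n. (if \<mu> =
      lam then 1 else 0) * schur \<mu> t)"
      using assms by (simp add: finite_partitions_of if_distrib[of "\<lambda>x. x * _"] cong: if_cong)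
  next
    fix C assume C: "(\<forall>\<mu>. \<mu> \<notin> partitions_of n \<longrightarrow> C \<mu> = 0) \<and>
      (\<forall>t :: nat \<Rightarrow> rat. schur lam (\<lambda>k. of_nat 1 * t k) = (\<Sum>\<mu>\<in>partitions_of n. C \<mu> * schur \<mu> t))"
    have "C mu - (if mu = lam then 1 else 0) = 0" if "mu \<in> partitions_of n" for mu
    proof (rule schur_linear_independent[OF _ that])
      fix t :: "nat \<Rightarrow> rat"
      have "(\<Sum>\<mu>\<in>partitions_of n. C \<mu> * schur \<mu> t) = schur lam t"
        using C by simp
      then show "(\<Sum>\<mu>\<in>partitions_of n. (C \<mu> - (if \<mu> = lam then 1 else 0)) * schur \<mu> t) = 0"
        using assms by (simp add: left_diff_distrib sum_subtractf finite_partitions_of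
            if_distrib[of "\<lambda>x. x * _"] cong: if_cong)
    qed
    then show "C = (\<lambda>mu. if mu = lam then 1 else 0)"
      using C assms by fastforce
  qed (use assms in auto)
qed

lemma homfly_torus_one:
  assumes "lam \<in> partitions_of k"
  shows "homfly_torus 1 n nu_half tau lam =
    tau powi (- kappa lam * n) * schur lam (t_star nu_half tau)"
proof -
  have k: "sum_list lam = k"
    using assms by (simp add: partitions_of_def)
  show ?thesis
    unfolding homfly_torus_def adams_coeff_one[OF assms] k
    using assms by (simp add: finite_partitions_of if_distrib[of "\<lambda>x. x *
      _"] if_distrib[of of_rat] cong: if_cong)
qed


section \<open>The wave function as a sum over one-row partitions\<close>

lemma schur_Nil [simp]: "schur [] t = 1"
  by (simp add: schur_def)

lemma schur_singleton: "schur [k] t = schur_row t (int k)"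
  by (simp add: schur_def det_single)

lemma partition_nth_neq_0: "lam \<in> partitions \<Longrightarrow> i < length lam \<Longrightarrow> lam ! i \<noteq> 0"
  using nth_mem[of i lam] by (metis (mono_tags, lifting) UN_iff mem_Collect_eq partitions_def
    partitions_of_def)

text \<open>The first two rows of the Jacobi-Trudi matrix consist of consecutive powers of \<open>x\<close> and are
  therefore proportional. Since the parts are positive, no entry of the second row has a
  negative index, where the power of \<open>x\<close> would be replaced by \<open>0\<close>.\<close>

lemma schur_geometric_eq_0:
  assumes "lam \<in> partitions" "length lam \<ge> 2"
  shows "schur lam (\<lambda>i. fps_X ^ i / of_nat i :: 'k::field_char_0 fps) = 0"
proof -
  let ?t = "\<lambda>i. fps_X ^ i / of_nat i :: 'k fps"
  let ?l = "length lam"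
  define A where "A = Matrix.mat ?l ?l (\<lambda>(i, j). schur_row ?t (int (lam ! i) - int i + int j))"
  \<comment> \<open>\<open>B\<close> is \<open>A\<close> with its first row replaced by the second one.\<close>
  define B where "B = Matrix.mat ?l ?l (\<lambda>(i, j). A $$ (if i = 0 then 1 else i, j))"
  have lam: "lam ! 1 \<le> lam ! 0" "lam ! 1 \<noteq> 0"
    using assms partition_nth_neq_0[of lam 1]
    by (auto simp: partitions_def partitions_of_def sorted_wrt_iff_nth_less)
  have row: "schur_row ?t (int a - int i + int j) = fps_X ^ (a + j - i)" if "i \<le> a" for a i j
  proof -
    have "int a - int i + int j = int (a + j - i)"
      using that by simp
    then show ?thesis
      by (simp only: schur_row_geometric)
  qed
  have "A = multrow 0 (fps_X ^ (lam ! 0 + 1 - lam ! 1)) B"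
  proof (rule eq_matI)
    fix i j
    assume "i < dim_row (multrow 0 (fps_X ^ (lam ! 0 + 1 - lam ! 1)) B)"
      and "j < dim_col (multrow 0 (fps_X ^ (lam ! 0 + 1 - lam ! 1)) B)"
    then have ij: "i < ?l" "j < ?l"
      by (simp_all add: B_def)
    then have "0 < ?l"
      by linarith
    have "A $$ (0, j) = fps_X ^ (lam ! 0 + j)"
      using row[of 0 "lam ! 0" j] ij \<open>0 < ?l\<close> by (simp add: A_def)
    moreover have "A $$ (1, j) = fps_X ^ (lam ! 1 + j - 1)"
      using row[of 1 "lam ! 1" j] ij assms(2) lam by (simp add: A_def)
    moreover have "lam ! 0 + 1 - lam ! 1 + (lam ! 1 + j - 1) = lam ! 0 + j"
      using lam by simp
    ultimately have "A $$ (0, j) = fps_X ^ (lam ! 0 + 1 - lam ! 1) * A $$ (1, j)"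
      by (simp only: power_add[symmetric])
    then show "A $$ (i, j) = multrow 0 (fps_X ^ (lam ! 0 + 1 - lam ! 1)) B $$ (i, j)"
      using ij by (cases "i = 0") (simp_all add: B_def)
  qed (simp_all add: A_def B_def)
  moreover have B: "B \<in> carrier_mat ?l ?l"
    by (simp add: B_def)
  moreover have "det B = 0"
  proof (rule det_identical_rows[OF B, of 0 1])
    have "0 < ?l" "1 < ?l"
      using assms(2) by auto
    then show "row B 0 = row B 1"
      by (intro eq_vecI) (simp_all add: B_def)
  qed (use assms(2) in auto)
  moreover have "0 < ?l"
    using assms(2) by linarith
  ultimately have "det A = 0"
    by (simp add: det_multrow[OF _ B])
  then show ?thesis
    by (simp add: schur_def A_def)
qed

lemma schur_at_zero:
  assumes "lam \<in> partitions" "lam \<noteq> []"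
  shows "schur lam (\<lambda>_. 0 :: 'k::field_char_0 fps) = 0"
proof -
  let ?l = "length lam"
  define A where "A = Matrix.mat ?l ?l (\<lambda>(i, j). schur_row (\<lambda>_. 0 :: 'k fps) (int (lam ! i) -
    int i + int j))"
  have "lam ! 0 \<noteq> 0"
    using assms partition_nth_neq_0[of lam 0] by simp
  then have "A $$ (0, j) = 0" if "j < ?l" for j
    using that assms schur_row_zero[of "lam ! 0 + j", where 'k = 'k] by (simp add: A_def)
  then have "A = multrow 0 0 A"
    by (intro eq_matI) (auto simp: A_def)
  then have "det A = det (multrow 0 0 A)"
    by simp
  also have "\<dots> = 0"
    using assms(2) by (subst det_multrow[of 0 ?l]) (simp_all add: A_def)
  finally show ?thesis
    by (simp add: schur_def A_def)
qed

text \<open>Partitions have no zero parts, so the partition \<open>(0)\<close> is the empty list.\<close>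

definition one_row :: "nat \<Rightarrow> nat list" where
  "one_row k = (if k = 0 then [] else [k])"

lemma one_row_in_partitions_of: "one_row k \<in> partitions_of k"
  by (simp add: one_row_def partitions_of_def)

lemma schur_row_0:
  fixes t :: "nat \<Rightarrow> 'k::field_char_0"
  shows "schur_row t 0 = 1"
  by (simp add: schur_row_def)

lemma schur_one_row:
  assumes "schur_row t 0 = 1"
  shows "schur (one_row k) t = schur_row t (int k)"
  using assms by (simp add: one_row_def schur_singleton)

lemma kappa_one_row: "kappa (one_row k) = int k * (int k - 1)"
proof -
  have "2 * (\<Sum>j = 1..k. int j - 1) = int k * (int k - 1)"
    by (induction k) (simp_all add: algebra_simps)
  then show ?thesis
    by (simp add: kappa_def one_row_def)
qed

lemma fps_has_sum_monomials:
  fixes c :: "nat \<Rightarrow> 'k::comm_ring_1"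
  shows "((\<lambda>k. fps_const (c k) * fps_X ^ k) has_sum Abs_fps c) UNIV"
  unfolding has_sum_def
proof (rule tendsto_fpsI)
  fix n
  show "eventually (\<lambda>F. fps_nth (\<Sum>k\<in>F. fps_const (c k) * fps_X ^ k) n = fps_nth (Abs_fps c) n)
    (finite_subsets_at_top UNIV)"
  proof (rule eventually_finite_subsets_at_top[THEN iffD2], intro exI[of _ "{n}"] conjI allI impI)
    fix F :: "nat set" assume F: "finite F \<and> {n} \<subseteq> F \<and> F \<subseteq> UNIV"
    have "fps_nth (\<Sum>k\<in>F. fps_const (c k) * fps_X ^ k) n = (\<Sum>k\<in>F. if k = n then c k else 0)"
      by (auto simp: fps_sum_nth intro!: sum.cong)
    also have "\<dots> = c n"
      using F by simp
    finally show "fps_nth (\<Sum>k\<in>F. fps_const (c k) * fps_X ^ k) n = fps_nth (Abs_fps c) n"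
      by simp
  qed auto
qed

text \<open>The sum over all partitions collapses to the power series with one term for each one-row
  partition; it converges in the \<open>x\<close>-adic topology because each coefficient stabilises.\<close>

lemma partition_function_eqI:
  fixes t :: "nat \<Rightarrow> 'k::field_char_0 fps"
  assumes "\<And>lam. lam \<in> partitions \<Longrightarrow> lam \<notin> range one_row \<Longrightarrow> schur lam t = 0"
    and "\<And>k. schur (one_row k) t = fps_const (b k) * fps_X ^ k"
  shows "partition_function m n nu_half tau t =
    Abs_fps (\<lambda>k. homfly_torus m n nu_half tau (one_row k) * b k)"
proof -
  let ?g = "\<lambda>lam. fps_const (homfly_torus m n nu_half tau lam) * schur lam t"
  have inj: "inj one_row"
    by (auto simp: inj_def one_row_def split: if_splits)
  have sub: "range one_row \<subseteq> partitions"
    using one_row_in_partitions_of by (auto simp: partitions_def)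
  have "((\<lambda>k. fps_const (homfly_torus m n nu_half tau (one_row k) * b k) * fps_X ^ k) has_sum
      Abs_fps (\<lambda>k. homfly_torus m n nu_half tau (one_row k) * b k)) UNIV"
    by (rule fps_has_sum_monomials)
  also have "(\<lambda>k. fps_const (homfly_torus m n nu_half tau (one_row k) * b k) * fps_X ^ k) =
    ?g \<circ> one_row"
    by (simp add: fun_eq_iff assms(2) flip: fps_const_mult mult.assoc)
  finally have "(?g has_sum Abs_fps (\<lambda>k. homfly_torus m n nu_half tau (one_row k) *
    b k)) (range one_row)"
    using has_sum_reindex[OF inj] by blast
  then have "(?g has_sum Abs_fps (\<lambda>k. homfly_torus m n nu_half tau (one_row k) * b k)) partitions"
    by (rule has_sum_cong_neutral[THEN iffD1, rotated -1]) (use sub assms(1) in auto)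
  then show ?thesis
    unfolding partition_function_def by (rule infsumI)
qed

lemma wave_function_one:
  fixes nu_half tau :: "'k::field_char_0"
  shows "wave_function 1 n nu_half tau =
    Abs_fps (\<lambda>k. tau powi (- (int k * (int k - 1)) * n) * schur_row (t_star nu_half tau) (int k))"
proof -
  have homfly: "homfly_torus 1 n nu_half tau (one_row k) =
      tau powi (- (int k * (int k - 1)) * n) * schur_row (t_star nu_half tau) (int k)" for k
    by (simp only: homfly_torus_one[OF one_row_in_partitions_of] kappa_one_row schur_one_row[OF
      schur_row_0])
  have long: "length lam \<ge> 2" if "lam \<in> partitions" "lam \<notin> range one_row" for lam
  proof (rule ccontr)
    assume "\<not> length lam \<ge> 2"
    then consider "lam = []" | k where "lam = [k]"
      by (cases lam rule: list.exhaust[case_product list.exhaust]; cases "tl lam") auto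
    then have "lam \<in> range one_row"
    proof cases
      case 1
      then show ?thesis by (auto simp: one_row_def image_iff)
    next
      case 2
      then show ?thesis
        using that(1) by (auto simp: one_row_def image_iff partitions_def partitions_of_def)
    qed
    with that show False by simp
  qed
  have "partition_function 1 n nu_half tau (\<lambda>i. fps_X ^ i / of_nat i) =
      Abs_fps (\<lambda>k. homfly_torus 1 n nu_half tau (one_row k) * 1)"
    using schur_row_geometric[of 0, where 'k = 'k]
    by (intro partition_function_eqI) (auto simp: schur_geometric_eq_0 long schur_one_row
      schur_row_geometric)
  moreover have "partition_function 1 n nu_half tau (\<lambda>_. 0) =
      Abs_fps (\<lambda>k. homfly_torus 1 n nu_half tau (one_row k) * (if k = 0 then 1 else 0))"
    using schur_row_zero[of 0, where 'k = 'k]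
    by (intro partition_function_eqI schur_at_zero) (auto simp: schur_singleton schur_row_zero
      one_row_def)
  moreover have "\<dots> = 1"
    by (rule fps_ext) (simp add: homfly[unfolded One_nat_def] schur_row_0)
  ultimately show ?thesis
    unfolding wave_function_def by (simp add: homfly[unfolded One_nat_def])
qed


section \<open>The shape of the paths\<close>

text \<open>Paths are cut before each up or diagonal step, so that left steps belong to the row whose
  first step arrives at their height.\<close>

definition path_row :: "bool \<times> nat \<Rightarrow> step list" where
  "path_row r = (if fst r then Diagonal else Up) # replicate (snd r) Left"

definition path_of_rows :: "nat \<Rightarrow> (bool \<times> nat) list \<Rightarrow> step list" where
  "path_of_rows b rs = replicate b Right @ concat (map path_row rs)"

lemma path_of_rows_Nil: "path_of_rows 0 [] = []"
  by (simp add: path_of_rows_def)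

lemma path_of_rows_Suc_Nil: "path_of_rows (Suc b) [] = path_of_rows b [] @ [Right]"
  by (simp add: path_of_rows_def replicate_append_same)

lemma path_of_rows_snoc_zero: "path_of_rows b (rs @ [(d, 0)]) =
  path_of_rows b rs @ [if d then Diagonal else Up]"
  by (simp add: path_of_rows_def path_row_def)

lemma path_of_rows_snoc_Suc: "path_of_rows b (rs @ [(d, Suc n)]) =
  path_of_rows b (rs @ [(d, n)]) @ [Left]"
  by (simp add: path_of_rows_def path_row_def replicate_append_same)

lemmas path_of_rows_simps =
  path_of_rows_Nil path_of_rows_Suc_Nil path_of_rows_snoc_zero path_of_rows_snoc_Suc

text \<open>Induction step by step rather than row by row: the vertices and the trace of a path are
  easy to follow when a single step is appended.\<close>

lemma rows_induct [case_names Nil Suc_right zero Suc]: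
  assumes "P 0 []" "\<And>b. P b [] \<Longrightarrow> P (Suc b) []"
    and "\<And>b rs d. P b rs \<Longrightarrow> P b (rs @ [(d, 0)])"
    and "\<And>b rs d n. P b (rs @ [(d, n)]) \<Longrightarrow> P b (rs @ [(d, Suc n)])"
  shows "P b rs"
proof (induction rs rule: rev_induct)
  case Nil
  show ?case by (induction b) (use assms in auto)
next
  case (snoc r rs)
  have "P b (rs @ [(d, n)])" for d n
    by (induction n) (use assms snoc in auto)
  then show ?case by (cases r) auto
qed

lemma rows_cases:
  obtains "b = (0::nat)" "rs = []" | b' where "b = Suc b'" "rs = []"
    | rs' d where "rs = rs' @ [(d :: bool, 0 :: nat)]" | rs' d n where "rs = rs' @ [(d, Suc n)]"
proof (cases rs rule: rev_cases)
  case Nil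
  then show ?thesis using that(1,2) by (cases b) auto
next
  case (snoc rs' r)
  obtain d n where "r = (d, n)" by fastforce
  with snoc show ?thesis using that(3,4) by (cases n) auto
qed

text \<open>The last step of the path tells which of the four construction steps came last.\<close>

lemma path_of_rows_inject:
  "path_of_rows b rs = path_of_rows b' rs' \<Longrightarrow> b = b' \<and> rs = rs'"
proof (induction b rs arbitrary: b' rs' rule: rows_induct)
  case Nil
  then show ?case
    by (cases b' rs' rule: rows_cases) (auto simp: path_of_rows_simps split: if_splits)
next
  case (Suc_right b)
  then show ?case
    by (cases b' rs' rule: rows_cases) (auto simp: path_of_rows_simps split: if_splits)
next
  case (zero b rs d)
  then show ?case
    by (cases b' rs' rule: rows_cases) (auto simp: path_of_rows_simps split: if_splits)
next
  case (Suc b rs d n)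
  then show ?case
    by (cases b' rs' rule: rows_cases) (fastforce simp: path_of_rows_simps split: if_splits)+
qed

lemma vertex_snoc:
  "vertex (p @ [s]) k = (if k \<le> length p then vertex p k else vertex p (length p) + displacement s)"
  by (auto simp: vertex_def)

definition final_x :: "nat \<Rightarrow> (bool \<times> nat) list \<Rightarrow> real" where
  "final_x b rs = real b + (\<Sum>r\<leftarrow>rs. of_bool (fst r) - real (snd r))"

lemma vertex_path_of_rows:
  "vertex (path_of_rows b rs) (length (path_of_rows b rs)) = (final_x b rs, real (length rs))"
  by (induction b rs rule: rows_induct)
    (auto simp: path_of_rows_simps vertex_snoc final_x_def, simp_all add: vertex_def zero_prod_def)

lemma count_list_path_of_rows: "count_list (path_of_rows b rs) Diagonal = (\<Sum>r\<leftarrow>rs. of_bool (fst r))"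
  by (induction rs)  (auto simp: path_of_rows_def path_row_def)


lemma all_steps_snoc:
  "(\<forall>k<length (p @ [s]). P ((p @ [s]) ! k) (vertex (p @ [s]) k)) \<longleftrightarrow>
   (\<forall>k<length p. P (p ! k) (vertex p k)) \<and> P s (vertex p (length p))"
  by (auto simp: less_Suc_eq nth_append vertex_snoc)

lemma ex_steps_snoc:
  "(\<exists>k<length (p @ [s]). P ((p @ [s]) ! k) (vertex (p @ [s]) k)) \<longleftrightarrow>
   (\<exists>k<length p. P (p ! k) (vertex p k)) \<or> P s (vertex p (length p))"
  by (auto simp: less_Suc_eq nth_append vertex_snoc)

lemma path_of_rows_horizontal:
  "\<forall>k<length (path_of_rows b rs). path_of_rows b rs ! k =
    Left \<longrightarrow> snd (vertex (path_of_rows b rs) k) \<noteq> 0"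
  "\<forall>k<length (path_of_rows b rs). path_of_rows b rs ! k =
    Right \<longrightarrow> snd (vertex (path_of_rows b rs) k) = 0"
proof (induction b rs rule: rows_induct)
  case Nil
  { case 1 show ?case by (simp add: path_of_rows_simps) }
  { case 2 show ?case by (simp add: path_of_rows_simps) }
next
  case (Suc_right b)
  { case 1 then show ?case
      using Suc_right by (simp only: path_of_rows_simps all_steps_snoc[where P = "\<lambda>s v. s =
        Left \<longrightarrow> snd v \<noteq> 0"]) simp }
  { case 2 then show ?case
      using Suc_right by (simp only: path_of_rows_simps all_steps_snoc[where P = "\<lambda>s v. s =
        Right \<longrightarrow> snd v = 0"]
        vertex_path_of_rows) simp }
next
  case (zero b rs d)
  { case 1 then show ?case
      using zero by (simp only: path_of_rows_simps all_steps_snoc[where P = "\<lambda>s v. s =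
        Left \<longrightarrow> snd v \<noteq> 0"]) simp }
  { case 2 then show ?case
      using zero by (simp only: path_of_rows_simps all_steps_snoc[where P = "\<lambda>s v. s =
        Right \<longrightarrow> snd v = 0"]) simp }
next
  case (Suc b rs d n)
  { case 1 then show ?case
      using Suc by (simp only: path_of_rows_simps all_steps_snoc[where P = "\<lambda>s v. s =
        Left \<longrightarrow> snd v \<noteq> 0"]
        vertex_path_of_rows) simp }
  { case 2 then show ?case
      using Suc by (simp only: path_of_rows_simps all_steps_snoc[where P = "\<lambda>s v. s =
        Right \<longrightarrow> snd v = 0"]) simp }
qed

text \<open>This turns the row condition into a condition on the numbers of left steps. The left steps
  at height \<open>r\<close> belong to the row that arrives at height \<open>r\<close>, whose index is \<open>r - 1\<close>.\<close>

lemma path_of_rows_left_in_row: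
  "(\<exists>k<length (path_of_rows b rs). path_of_rows b rs ! k =
    Left \<and> snd (vertex (path_of_rows b rs) k) = real r) \<longleftrightarrow>
   0 < r \<and> r \<le> length rs \<and> snd (rs ! (r - 1)) \<noteq> 0"
proof (induction b rs rule: rows_induct)
  case Nil
  show ?case by (auto simp: path_of_rows_simps)
next
  case (Suc_right b)
  then show ?case
    by (simp only: path_of_rows_simps ex_steps_snoc[where P = "\<lambda>s v. s = Left \<and> snd v =
      real r"]) simp
next
  case (zero b rs d)
  then show ?case
    by (simp only: path_of_rows_simps ex_steps_snoc[where P = "\<lambda>s v. s = Left \<and> snd v = real r"])
      (cases "r = Suc (length rs)"; auto simp: nth_append)
next
  case (Suc b rs d n)
  then show ?case
    by (simp only: path_of_rows_simps ex_steps_snoc[where P = "\<lambda>s v. s = Left \<and> snd v = real r"]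
        vertex_path_of_rows) (cases "r = Suc (length rs)"; auto simp: nth_append)
qed

text \<open>Right steps only at height \<open>0\<close> and left steps only above it leave no other shape: a right
  step can only extend a path without rows, and a left step can only extend the last row.\<close>

lemma ex_path_of_rows:
  assumes "\<forall>k<length p. p ! k = Left \<longrightarrow> snd (vertex p k) \<noteq> 0"
    and "\<forall>k<length p. p ! k = Right \<longrightarrow> snd (vertex p k) = 0"
  shows "\<exists>b rs. p = path_of_rows b rs"
  using assms
proof (induction p rule: rev_induct)
  case Nil
  show ?case using path_of_rows_Nil by metis
next
  case (snoc s p)
  note 1 = snoc.prems(1)[unfolded all_steps_snoc[where P = "\<lambda>s v. s = Left \<longrightarrow> snd v \<noteq> 0"]]
  note 2 = snoc.prems(2)[unfolded all_steps_snoc[where P = "\<lambda>s v. s = Right \<longrightarrow> snd v = 0"]]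
  from snoc.IH[OF 1[THEN conjunct1] 2[THEN conjunct1]] obtain b rs where p: "p = path_of_rows b rs"
    by blast
  have h: "snd (vertex p (length p)) = real (length rs)"
    by (simp add: p vertex_path_of_rows)
  show ?case
  proof (cases s)
    case Left
    with 1 h obtain rs' r where "rs = rs' @ [r]"
      by (cases rs rule: rev_cases) auto
    moreover obtain d n where "r = (d, n)" by fastforce
    ultimately have "p @ [s] = path_of_rows b (rs' @ [(d, Suc n)])"
      by (simp add: p Left path_of_rows_snoc_Suc)
    then show ?thesis by blast
  next
    case Right
    with 2 h have "p @ [s] = path_of_rows (Suc b) []"
      by (simp add: p path_of_rows_Suc_Nil)
    then show ?thesis by blast
  next
    case Up
    then have "p @ [s] = path_of_rows b (rs @ [(False, 0)])"
      by (simp add: p path_of_rows_snoc_zero)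
    then show ?thesis by blast
  next
    case Diagonal
    then have "p @ [s] = path_of_rows b (rs @ [(True, 0)])"
      by (simp add: p path_of_rows_snoc_zero)
    then show ?thesis by blast
  qed
qed

text \<open>Two adjacent horizontal steps have the same height, but left and right steps never do.\<close>

lemma no_adjacent_left_right:
  assumes "\<forall>k<length p. p ! k = Left \<longrightarrow> snd (vertex p k) \<noteq> 0"
    and "\<forall>k<length p. p ! k = Right \<longrightarrow> snd (vertex p k) = 0"
    and "Suc k < length p"
  shows "(p ! k, p ! Suc k) \<noteq> (Left, Right) \<and> (p ! k, p ! Suc k) \<noteq> (Right, Left)"
proof -
  have "vertex p (Suc k) = vertex p k + displacement (p ! k)"
    using assms(3) by (simp add: vertex_def take_Suc_conv_app_nth)
  then show ?thesis
    using assms(1)[rule_format, of k] assms(1)[rule_format, of "Suc k"]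
      assms(2)[rule_format, of k] assms(2)[rule_format, of "Suc k"] assms(3) by auto
qed

lemma path_trace_snoc:
  "path_trace (p @ [s]) =
    path_trace p \<union> closed_segment (vertex p (length p)) (vertex p (length p) + displacement s)"
  by (auto simp: path_trace_def less_Suc_eq vertex_snoc)

text \<open>Along the initial right steps \<open>x - f * y\<close> is nonnegative, and every later step decreases
  it or leaves it unchanged; for a diagonal step this needs \<open>f \<ge> 1\<close>. So \<open>x - f * y\<close> is never
  below both \<open>0\<close> and its final value.\<close>

lemma path_of_rows_vertex_below:
  assumes "f \<ge> 1" "k \<le> length (path_of_rows b rs)"
  shows "fst (vertex (path_of_rows b rs) k) - real f * snd (vertex (path_of_rows b rs) k) \<ge>
    min 0 (final_x b rs - real f * real (length rs))"
  using assms(2)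
proof (induction b rs rule: rows_induct)
  case Nil
  then show ?case by (simp add: path_of_rows_simps vertex_def)
next
  case (Suc_right b)
  then show ?case
    by (auto simp: path_of_rows_simps vertex_snoc vertex_path_of_rows final_x_def)
next
  case (zero b rs d)
  then show ?case
    using assms(1) by (auto simp: path_of_rows_simps vertex_snoc vertex_path_of_rows final_x_def
      algebra_simps min_def split: if_splits)
next
  case (Suc b rs d n)
  then show ?case
    by (auto simp: path_of_rows_simps vertex_snoc vertex_path_of_rows final_x_def min_def
      algebra_simps split: if_splits)
qed

lemma path_of_rows_below_line:
  assumes "f \<ge> 1" "final_x b rs = real (f * length rs)" "(x, y) \<in> path_trace (path_of_rows b rs)"
  shows "real f * y \<le> x"
proof -
  let ?H = "{v :: real \<times> real. 0 \<le> fst v - real f * snd v}"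
  have "linear (\<lambda>v :: real \<times> real. fst v - real f * snd v)"
    by (intro linearI) (simp_all add: algebra_simps)
  from convex_linear_vimage[OF this, of "{0..}"] have "convex ?H"
    by (simp add: vimage_def)
  moreover have "vertex (path_of_rows b rs) k \<in> ?H" if "k \<le> length (path_of_rows b rs)" for k
    using path_of_rows_vertex_below[OF assms(1) that] assms(2) by simp
  ultimately have "closed_segment (vertex (path_of_rows b rs) k) (vertex (path_of_rows b rs) (Suc
    k)) \<subseteq> ?H"
    if "k < length (path_of_rows b rs)" for k
    using that by (intro closed_segment_subset) auto
  then have "path_trace (path_of_rows b rs) \<subseteq> ?H"
    by (auto simp: path_trace_def)
  with assms(3) show ?thesis
    by auto
qed

section \<open>The enclosed area\<close>

text \<open>The abscissa, at height \<open>y\<close>, of the line through the up or diagonal step of row \<open>s\<close>.\<close>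

definition row_line :: "nat \<Rightarrow> (bool \<times> nat) list \<Rightarrow> nat \<Rightarrow> real \<Rightarrow> real" where
  "row_line b rs s y = final_x b (take s rs) + of_bool (fst (rs ! s)) * (y - real s)"

lemma mem_slanted_segment:
  "(x, y) \<in> closed_segment (x0, y0) (x0 + d, y0 + 1) \<longleftrightarrow>
    y0 \<le> y \<and> y \<le> y0 + 1 \<and> x = x0 + d * (y - (y0 :: real))"
proof
  assume "(x, y) \<in> closed_segment (x0, y0) (x0 + d, y0 + 1)"
  then obtain u where "0 \<le> u" "u \<le> 1" "x = (1 - u) * x0 + u * (x0 + d)" "y =
    (1 - u) * y0 + u * (y0 + 1)"
    by (auto simp: closed_segment_def)
  then show "y0 \<le> y \<and> y \<le> y0 + 1 \<and> x = x0 + d * (y - y0)"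
    by (auto simp: algebra_simps)
next
  assume "y0 \<le> y \<and> y \<le> y0 + 1 \<and> x = x0 + d * (y - y0)"
  then show "(x, y) \<in> closed_segment (x0, y0) (x0 + d, y0 + 1)"
    by (auto simp: closed_segment_def algebra_simps intro!: exI[of _ "y - y0"])
qed

lemma mem_horizontal_segment:
  "(x, y) \<in> closed_segment (x0, y0) (x1, y0) \<Longrightarrow> y = (y0 :: real)"
  by (auto simp: closed_segment_def algebra_simps)

lemma row_line_in_path_trace:
  assumes "s < length rs" "real s \<le> y" "y \<le> real s + 1"
  shows "(row_line b rs s y, y) \<in> path_trace (path_of_rows b rs)"
  using assms(1)
proof (induction b rs rule: rows_induct)
  case (zero b rs d)
  then show ?case
    using assms(2,3) mem_slanted_segment[of "row_line b (rs @ [(d, 0)]) s y" y "final_x b rs"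
      "real s" "of_bool d"]
    by (cases "s = length rs")
      (auto simp: path_of_rows_simps path_trace_snoc vertex_path_of_rows row_line_def nth_append)
next
  case (Suc b rs d n)
  have "row_line b (rs @ [(d, Suc n)]) s y = row_line b (rs @ [(d, n)]) s y"
    using Suc.prems by (auto simp: row_line_def nth_append)
  with Suc show ?case
    by (simp add: path_of_rows_simps path_trace_snoc)
qed simp_all

text \<open>At a non-integer height the path has at most one point, so the section of the enclosed
  region is an interval or empty there. Integer heights, where the path has horizontal pieces,
  form a null set.\<close>

lemma path_trace_at_non_integer_height:
  assumes "y \<notin> \<int>" "(x, y) \<in> path_trace (path_of_rows b rs)"
  shows "\<exists>s<length rs. real s < y \<and> y < real s + 1 \<and> x = row_line b rs s y"
  using assms(2)
proof (induction b rs rule: rows_induct)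
  case Nil
  then show ?case using assms(1) by (auto simp: path_trace_def path_of_rows_simps)
next
  case (Suc_right b)
  then show ?case
    using assms(1) by (auto simp: path_of_rows_simps path_trace_snoc vertex_path_of_rows dest!:
      mem_horizontal_segment)
next
  case (zero b rs d)
  let ?rs = "rs @ [(d, 0)]"
  have "y \<noteq> real k" "y \<noteq> real k + 1" for k
    using assms(1) by (metis Ints_of_nat, metis Ints_of_nat of_nat_Suc add.commute)
  moreover from zero.prems consider "(x, y) \<in> path_trace (path_of_rows b rs)"
    | "(x, y) \<in> closed_segment (final_x b rs, real (length rs)) (final_x b rs +
      of_bool d, real (length rs) + 1)"
    by (auto simp: path_of_rows_simps path_trace_snoc vertex_path_of_rows split: if_splits)
  then show ?case
  proof cases
    case 1
    from zero.IH[OF this] obtain s where "s < length rs" "real s < y" "y < real s + 1" "x =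
      row_line b rs s y"
      by blast
    then show ?thesis
      by (intro exI[of _ s]) (simp add: row_line_def nth_append)
  next
    case 2
    then show ?thesis
      unfolding mem_slanted_segment using calculation
      by (intro exI[of _ "length rs"]) (auto simp: row_line_def less_le)
  qed
next
  case (Suc b rs d n)
  have "row_line b (rs @ [(d, Suc n)]) s y = row_line b (rs @ [(d, n)]) s y" if "s \<le> length rs"
    for s
    using that by (auto simp: row_line_def nth_append)
  moreover have "(x, y) \<in> path_trace (path_of_rows b (rs @ [(d, n)]))"
    using Suc.prems assms(1)
    by (auto simp: path_of_rows_simps path_trace_snoc vertex_path_of_rows dest!:
      mem_horizontal_segment)
  ultimately show ?case
    using Suc.IH by (auto simp: less_Suc_eq_le)
qed


text \<open>The points to the left of a point of the path are the Minkowski sum of the path, which is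
  compact, and of a closed horizontal ray. Closedness gives the measurability needed for
  Fubini.\<close>

lemma closed_enclosed_region: "closed (enclosed_region f p)"
proof -
  have "compact (path_trace p)"
    unfolding path_trace_def by (intro compact_insert compact_UN) auto
  moreover have "closed {v :: real \<times> real. fst v \<le> 0 \<and> snd v = 0}"
    by (intro closed_Collect_conj closed_Collect_le closed_Collect_eq continuous_intros)
  ultimately have "closed (\<Union>v\<in>path_trace p. \<Union>w\<in>{v. fst v \<le> 0 \<and> snd v = 0}. {v + w})"
    by (rule compact_closed_sums)
  moreover have "closed {v :: real \<times> real. real f * snd v \<le> fst v}"
    by (intro closed_Collect_le continuous_intros)
  moreover have "enclosed_region f p = {v. real f * snd v \<le> fst v} \<inter>
      (\<Union>v\<in>path_trace p. \<Union>w\<in>{v. fst v \<le> 0 \<and> snd v = 0}. {v + w})"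
  proof (intro subset_antisym subrelI)
    fix x y assume "(x, y) \<in> enclosed_region f p"
    then obtain x' where "real f * y \<le> x" "x \<le> x'" "(x', y) \<in> path_trace p"
      by (auto simp: enclosed_region_def)
    then show "(x, y) \<in> {v. real f * snd v \<le> fst v} \<inter>
        (\<Union>v\<in>path_trace p. \<Union>w\<in>{v. fst v \<le> 0 \<and> snd v = 0}. {v + w})"
      by (intro IntI UN_I[of "(x', y)"] UN_I[of "(x - x', 0)"]) simp_all
  next
    fix x y assume "(x, y) \<in> {v. real f * snd v \<le> fst v} \<inter>
        (\<Union>v\<in>path_trace p. \<Union>w\<in>{v. fst v \<le> 0 \<and> snd v = 0}. {v + w})"
    then obtain v w where *: "real f * y \<le> x" "v \<in> path_trace p" "fst w \<le> 0" "snd w = 0" "(x, y) =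
      v + w"
      unfolding Int_iff UN_iff mem_Collect_eq singleton_iff fst_conv snd_conv by blast
    from *(5) have "fst v + fst w = x" "snd v + snd w = y"
      by (metis fst_add fst_conv, metis snd_add snd_conv)
    with * have "(fst v, y) \<in> path_trace p" "x \<le> fst v"
      by auto
    with *(1) show "(x, y) \<in> enclosed_region f p"
      by (auto simp: enclosed_region_def)
  qed
  ultimately show ?thesis
    by (simp only: closed_Int)
qed

lemma emeasure_section:
  assumes "f \<ge> 1" "y \<notin> \<int>"
  shows "emeasure lborel ((\<lambda>x. (x, y)) -` enclosed_region f (path_of_rows b rs)) =
    (\<Sum>s<length rs. ennreal (row_line b rs s y - real f * y) * indicator {real s..real s + 1} y)"
proof (cases "\<exists>s<length rs. real s < y \<and> y < real s + 1")
  case True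
  then obtain s where s: "s < length rs" "real s < y" "y < real s + 1"
    by blast
  have uniq: "s' = s" if "real s' \<le> y" "y \<le> real s' + 1" for s'
    using that s by linarith
  have "(\<lambda>x. (x, y)) -` enclosed_region f (path_of_rows b rs) = {real f * y..row_line b rs s y}"
  proof (intro subset_antisym subsetI)
    fix x assume "x \<in> (\<lambda>x. (x, y)) -` enclosed_region f (path_of_rows b rs)"
    then obtain x' where x': "real f * y \<le> x" "x \<le> x'" "(x', y) \<in> path_trace (path_of_rows b rs)"
      by (auto simp: enclosed_region_def)
    obtain s' where "real s' < y" "y < real s' + 1" "x' = row_line b rs s' y"
      using path_trace_at_non_integer_height[OF assms(2) x'(3)] by blast
    moreover from this have "s' = s"
      by (intro uniq) simp_all
    ultimately show "x \<in> {real f * y..row_line b rs s y}"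
      using x' by simp
  next
    fix x assume "x \<in> {real f * y..row_line b rs s y}"
    then show "x \<in> (\<lambda>x. (x, y)) -` enclosed_region f (path_of_rows b rs)"
      using row_line_in_path_trace[of s rs y b] s by (auto simp: enclosed_region_def)
  qed
  moreover have "(\<Sum>s<length rs. ennreal (row_line b rs s y -
    real f * y) * indicator {real s..real s + 1} y) =
      (\<Sum>s'<length rs. if s' = s then ennreal (row_line b rs s y - real f * y) else 0)"
    using s uniq by (intro sum.cong refl) (auto simp: indicator_def)
  ultimately show ?thesis
    using s by (cases "real f * y \<le> row_line b rs s y") (simp_all add: ennreal_neg)
next
  case False
  have "(\<lambda>x. (x, y)) -` enclosed_region f (path_of_rows b rs) = {}"
    using False path_trace_at_non_integer_height[OF assms(2), of _ b rs]
    by (auto simp: enclosed_region_def)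
  moreover have "y \<notin> {real s..real s + 1}" if "s < length rs" for s
  proof
    assume "y \<in> {real s..real s + 1}"
    moreover have "y \<noteq> real s" "y \<noteq> real s + 1"
      using assms(2) by (metis Ints_of_nat, metis Ints_of_nat of_nat_Suc add.commute)
    ultimately have "real s < y" "y < real s + 1"
      by simp_all
    with False that show False
      by blast
  qed
  ultimately show ?thesis
    by simp
qed

text \<open>Fubini: integrate the lengths of the horizontal sections, one strip \<open>s \<le> y \<le> s + 1\<close> at a
  time.\<close>

lemma measure_enclosed_region:
  assumes "f \<ge> 1" "final_x b rs = real (f * length rs)"
  shows "measure lborel (enclosed_region f (path_of_rows b rs)) =
    (\<Sum>s<length rs. final_x b (take s rs) + of_bool (fst (rs ! s)) / 2 - real f * (2 * real s +
      1) / 2)"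
proof -
  \<comment> \<open>\<open>F s\<close> is an antiderivative of the section length in the strip of row \<open>s\<close>.\<close>
  define F where "F s y = final_x b (take s rs) * y + of_bool (fst (rs ! s)) * (y -
    real s)\<^sup>2 / 2 - real f * y\<^sup>2 / 2"
    for s y
  let ?R = "enclosed_region f (path_of_rows b rs)"
  have nonneg: "0 \<le> row_line b rs s y - real f * y"
    if "s < length rs" "real s \<le> y" "y \<le> real s + 1" for s y
    using path_of_rows_below_line[OF assms row_line_in_path_trace[OF that]] by simp
  have FTC: "(\<integral>\<^sup>+y. ennreal (row_line b rs s y - real f * y) * indicator {real s..real s +
    1} y \<partial>lborel) =
      ennreal (F s (real s + 1) - F s (real s))" if "s < length rs" for s
  proof (rule nn_integral_FTC_Icc)
    show "(\<lambda>y. row_line b rs s y - real f * y) \<in> borel_measurable borel"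
      unfolding row_line_def by measurable
    show "((F s) has_real_derivative (row_line b rs s y - real f * y)) (at y)" for y
      unfolding F_def row_line_def by (auto intro!: derivative_eq_intros)
    show "0 \<le> row_line b rs s y - real f * y" if "y \<in> {real s..real s + 1}" for y
      using nonneg \<open>s < length rs\<close> that by simp
  qed simp
  have F_nonneg: "0 \<le> F s (real s + 1) - F s (real s)" if "s < length rs" for s
    using nonneg[OF that, of "real s"] nonneg[OF that, of "real s + 1"]
    unfolding F_def row_line_def by (auto simp: power2_eq_square algebra_simps)
  have "?R \<in> sets (lborel \<Otimes>\<^sub>M lborel)"
    unfolding lborel_prod using closed_enclosed_region by (simp add: borel_closed)
  then have "emeasure lborel ?R = (\<integral>\<^sup>+y. emeasure lborel ((\<lambda>x. (x, y)) -` ?R) \<partial>lborel)"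
    using lborel_pair.emeasure_pair_measure_alt2 unfolding lborel_prod by blast
  also have "\<dots> = (\<integral>\<^sup>+y. (\<Sum>s<length rs. ennreal (row_line b rs s y -
    real f * y) * indicator {real s..real s + 1} y) \<partial>lborel)"
  proof (rule nn_integral_cong_AE)
    have "AE y in lborel. y \<notin> (\<int> :: real set)"
      by (intro AE_not_in countable_imp_null_set_lborel) (auto simp: Ints_def)
    then show "AE y in lborel. emeasure lborel ((\<lambda>x. (x, y)) -` ?R) =
        (\<Sum>s<length rs. ennreal (row_line b rs s y - real f * y) * indicator {real s..real s + 1} y)"
      by eventually_elim (rule emeasure_section[OF assms(1)])
  qed
  also have "\<dots> = (\<Sum>s<length rs. \<integral>\<^sup>+y. ennreal (row_line b rs s y -
    real f * y) * indicator {real s..real s + 1} y \<partial>lborel)"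
    by (rule nn_integral_sum) (simp add: row_line_def)
  also have "\<dots> = (\<Sum>s<length rs. ennreal (F s (real s + 1) - F s (real s)))"
    by (intro sum.cong refl FTC) simp
  also have "\<dots> = ennreal (\<Sum>s<length rs. F s (real s + 1) - F s (real s))"
    using F_nonneg by (subst sum_ennreal) auto
  finally have emeasure: "emeasure lborel ?R =
    ennreal (\<Sum>s<length rs. F s (real s + 1) - F s (real s))" .
  have "0 \<le> (\<Sum>s<length rs. F s (real s + 1) - F s (real s))"
    using F_nonneg by (intro sum_nonneg) simp
  then have "measure lborel ?R = (\<Sum>s<length rs. F s (real s + 1) - F s (real s))"
    unfolding measure_def emeasure by (rule enn2real_ennreal)
  also have "\<dots> = (\<Sum>s<length rs. final_x b (take s rs) + of_bool (fst (rs ! s)) / 2 -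
    real f * (2 * real s + 1) / 2)"
    by (intro sum.cong refl) (simp add: F_def power2_eq_square field_simps)
  finally show ?thesis .
qed

text \<open>Summation by parts: each abscissa is the final one corrected by all the later rows, so a
  left step of row \<open>s\<close> matters for each of the \<open>s + 1\<close> strips below it.\<close>

lemma sum_final_x:
  "(\<Sum>s<length rs. 2 * final_x b (take s rs) + of_bool (fst (rs ! s))) =
    2 * real (length rs) * final_x b rs +
    (\<Sum>s<length rs. 2 * (real s + 1) * real (snd (rs ! s)) - (2 * real s +
      1) * of_bool (fst (rs ! s)))"
proof (induction rs rule: rev_induct)
  case (snoc r rs)
  then show ?case
    by (simp add: nth_append final_x_def algebra_simps)
qed simp

lemma sum_odd_real: "(\<Sum>s<n. 2 * real s + 1) = (real n)\<^sup>2"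
  by (induction n) (simp_all add: power2_eq_square algebra_simps)

lemma twice_area:
  assumes "f \<ge> 1" "final_x b rs = real (f * length rs)"
  shows "2 * measure lborel (enclosed_region f (path_of_rows b rs)) =
    real f * (real (length rs))\<^sup>2 +
    (\<Sum>s<length rs. 2 * (real s + 1) * real (snd (rs ! s)) - (2 * real s +
      1) * of_bool (fst (rs ! s)))"
proof -
  have "2 * measure lborel (enclosed_region f (path_of_rows b rs)) =
      (\<Sum>s<length rs. 2 * final_x b (take s rs) + of_bool (fst (rs ! s))) -
        real f * (\<Sum>s<length rs. 2 * real s + 1)"
    unfolding measure_enclosed_region[OF assms] sum_distrib_left sum_subtractf[symmetric]
    by (intro sum.cong refl) (simp add: field_simps)
  then show ?thesis
    unfolding sum_final_x sum_odd_real assms(2) by (simp add: power2_eq_square algebra_simps)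
qed

text \<open>Apart from the two totals \<open>i\<close> and \<open>j\<close>, the conditions treat each row separately, and the
  one on \<open>final_x\<close> merely fixes \<open>b\<close>. For \<open>l = 0\<close> only the empty path remains, since without rows the end point
  forces \<open>b = 0\<close>.\<close>

lemma backward_path_iff:
  assumes "f \<ge> 1"
  shows "backward_path f i j l p \<longleftrightarrow> (\<exists>b rs. p = path_of_rows b rs \<and> length rs = l \<and>
    final_x b rs = real (f * l) \<and> i = 2 * (\<Sum>r\<leftarrow>rs. of_bool (fst r)) \<and>
    (\<forall>s. Suc s < l \<longrightarrow> snd (rs ! s) \<noteq> 0) \<and>
    real j = real f * (real l)\<^sup>2 +
      (\<Sum>s<l. 2 * (real s + 1) * real (snd (rs ! s)) - (2 * real s + 1) * of_bool (fst (rs ! s))))"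
    (is "_ \<longleftrightarrow> ?rhs")
proof
  assume p: "backward_path f i j l p"
  have "\<exists>b rs. p = path_of_rows b rs"
  proof (cases "l = 0")
    case True
    then have "p = path_of_rows 0 []"
      using p by (simp add: backward_path_def row_condition_def path_of_rows_Nil)
    then show ?thesis by blast
  next
    case False
    then show ?thesis
      using p by (intro ex_path_of_rows) (auto simp: backward_path_def row_condition_def)
  qed
  then obtain b rs where p_eq: "p = path_of_rows b rs"
    by blast
  have end_pt: "length rs = l" "final_x b rs = real (f * l)"
    using p by (simp_all add: backward_path_def p_eq vertex_path_of_rows)
  have "real (count_list p Diagonal) = real i / 2"
    using p by (simp add: backward_path_def)
  then have "i = 2 * (\<Sum>r\<leftarrow>rs. of_bool (fst r))"
    unfolding p_eq count_list_path_of_rows by linarith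
  moreover have "snd (rs ! s) \<noteq> 0" if "Suc s < l" for s
  proof -
    have "\<exists>k<length p. p ! k = Left \<and> snd (vertex p k) = real (Suc s)"
      using p that by (auto simp: backward_path_def row_condition_def split: if_splits simp del:
        of_nat_Suc)
    then show ?thesis
      unfolding p_eq path_of_rows_left_in_row by simp
  qed
  moreover have "measure lborel (enclosed_region f p) = real j / 2"
    using p by (simp add: backward_path_def)
  ultimately show ?rhs
    using end_pt twice_area[OF assms, of b rs] p_eq by (intro exI[of _ b] exI[of _ rs]) simp
next
  assume ?rhs
  then obtain b rs where p: "p = path_of_rows b rs" and l: "length rs = l" and "final_x b rs =
    real (f * l)"
    and i: "i = 2 * (\<Sum>r\<leftarrow>rs. of_bool (fst r))" and left: "\<And>s. Suc s < l \<Longrightarrow> snd (rs ! s) \<noteq> 0"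
    and j: "real j = real f * (real l)\<^sup>2 +
      (\<Sum>s<l. 2 * (real s + 1) * real (snd (rs ! s)) - (2 * real s + 1) * of_bool (fst (rs ! s)))"
    by blast
  then have x: "final_x b rs = real (f * length rs)"
    by simp
  note horizontal = path_of_rows_horizontal[of b rs, folded p]
  have "row_condition l p"
  proof (cases "l = 0")
    case True
    then have "rs = []" "b = 0"
      using x l by (simp_all add: final_x_def)
    then show ?thesis
      by (simp add: True row_condition_def p path_of_rows_Nil)
  next
    case False
    have "\<exists>k<length p. p ! k = Left \<and> snd (vertex p k) = real r" if "r \<in> {1..<l}" for r
      unfolding p path_of_rows_left_in_row using left[of "r - 1"] that l by auto
    then show ?thesis
      using False horizontal by (simp add: row_condition_def)
  qed
  moreover have "vertex p (length p) = (real (f * l), real l)"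
    unfolding p vertex_path_of_rows using x l by simp
  moreover have "real (count_list p Diagonal) = real i / 2"
    unfolding p count_list_path_of_rows i by simp
  moreover have "\<forall>(x, y)\<in>path_trace p. y \<le> x / real f"
    using path_of_rows_below_line[OF assms x] assms unfolding p by (auto simp: field_simps)
  moreover have "measure lborel (enclosed_region f p) = real j / 2"
    using twice_area[OF assms x] unfolding p j l by simp
  ultimately show "backward_path f i j l p"
    unfolding backward_path_def using no_adjacent_left_right[OF horizontal] by blast
qed


section \<open>Counting paths\<close>

text \<open>Every row but the last needs a left step. Adding it to arbitrary numbers of left steps
  parametrises the admissible rows by unrestricted lists, which are easier to count.\<close>

definition bump :: "(bool \<times> nat) list \<Rightarrow> (bool \<times> nat) list" where
  "bump es = map (\<lambda>s. (fst (es ! s), snd (es ! s) + of_bool (Suc s < length es))) [0..<length es]"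

lemma length_bump [simp]: "length (bump es) = length es"
  by (simp add: bump_def)

lemma nth_bump: "s < length es \<Longrightarrow> bump es ! s =
  (fst (es ! s), snd (es ! s) + of_bool (Suc s < length es))"
  by (simp add: bump_def)

lemma inj_bump: "inj bump"
proof (rule injI)
  fix es es' assume eq: "bump es = bump es'"
  then have len: "length es = length es'"
    by (metis length_bump)
  show "es = es'"
  proof (rule nth_equalityI[OF len])
    fix s assume "s < length es"
    then show "es ! s = es' ! s"
      using arg_cong[OF eq, of "\<lambda>es. es ! s"] len by (simp add: nth_bump prod_eq_iff)
  qed
qed

lemma ex_bump:
  assumes "\<And>s. Suc s < length rs \<Longrightarrow> snd (rs ! s) \<noteq> 0"
  shows "\<exists>es. rs = bump es"
proof
  show "rs = bump (map (\<lambda>s. (fst (rs ! s), snd (rs ! s) -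
    of_bool (Suc s < length rs))) [0..<length rs])"
    using assms by (intro nth_equalityI) (auto simp: nth_bump prod_eq_iff Suc_leI of_bool_def)
qed

definition diagonals :: "(bool \<times> nat) list \<Rightarrow> nat" where
  "diagonals es = (\<Sum>e\<leftarrow>es. of_bool (fst e))"

text \<open>Twice the area above its minimum \<open>f * l\<^sup>2 - l\<close>. The minimum is attained by diagonal steps
  throughout and no left steps besides the compulsory ones.\<close>

definition excess :: "(bool \<times> nat) list \<Rightarrow> nat" where
  "excess es = (\<Sum>s<length es. 2 * Suc s * snd (es ! s) + (if fst (es ! s) then 0 else 2 * s + 1))"

lemma diagonals_le: "diagonals es \<le> length es"
  by (induction es) (auto simp: diagonals_def)

lemma diagonals_bump: "diagonals (bump es) = diagonals es"
  by (auto simp: diagonals_def sum_list_sum_nth nth_bump intro!: sum.cong)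

lemma area_bump:
  assumes "f \<ge> 1" "length es = l"
  shows "real f * (real l)\<^sup>2 +
      (\<Sum>s<l. 2 * (real s + 1) * real (snd (bump es ! s)) - (2 * real s +
        1) * of_bool (fst (bump es ! s))) =
    real (f * l\<^sup>2 - l + excess es)"
proof -
  have le: "l \<le> f * l\<^sup>2"
    using assms(1) by (simp add: power2_eq_square)
  \<comment> \<open>The compulsory left steps contribute \<open>l * (l - 1)\<close>, and diagonal steps in all rows remove
    \<open>l\<^sup>2\<close>.\<close>
  have corner: "(\<Sum>s<l. 2 * (real s + 1) * of_bool (Suc s < l) - (2 * real s + 1)) = - real l"
  proof (cases l)
    case (Suc m)
    have "(\<Sum>s<m. 2 * (real s + 1) * of_bool (Suc s < l) - (2 * real s + 1)) = (\<Sum>s<m. 1)"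
      by (intro sum.cong refl) (auto simp: Suc)
    then show ?thesis
      by (simp add: Suc)
  qed simp
  have "(\<Sum>s<l. 2 * (real s + 1) * real (snd (bump es ! s)) - (2 * real s +
    1) * of_bool (fst (bump es ! s))) =
      (\<Sum>s<l. real (2 * Suc s * snd (es ! s) + (if fst (es ! s) then 0 else 2 * s + 1)) +
        (2 * (real s + 1) * of_bool (Suc s < l) - (2 * real s + 1)))"
    using assms(2) by (intro sum.cong refl) (auto simp: nth_bump algebra_simps)
  also have "\<dots> = real (excess es) - real l"
    unfolding sum.distrib corner by (simp add: excess_def assms(2))
  finally show ?thesis
    using le by (simp add: of_nat_diff)
qed

definition codes :: "nat \<Rightarrow> nat \<Rightarrow> nat \<Rightarrow> (bool \<times> nat) list set" where
  "codes l i w = {es. length es = l \<and> 2 * diagonals es = i \<and> excess es = w}"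

text \<open>The codes parametrise the paths bijectively. The number \<open>start\<close> of right steps is the one
  required by the end point; the subtraction in it does not truncate because there are at most
  \<open>l \<le> f * l\<close> diagonal steps.\<close>

lemma path_count_eq:
  assumes "f \<ge> 1"
  shows "path_count f i j l = (if j < f * l\<^sup>2 - l then 0 else card (codes l i (j - (f * l\<^sup>2 - l))))"
proof -
  define C where "C = {es. length es = l \<and> 2 * diagonals es = i \<and> f * l\<^sup>2 - l + excess es = j}"
  define start where "start rs = f * l + (\<Sum>r\<leftarrow>rs. snd r) - diagonals rs"
    for rs :: "(bool \<times> nat) list"
  define path where "path es = path_of_rows (start (bump es)) (bump es)" for es
  have start: "final_x b rs = real (f * l) \<longleftrightarrow> b = start rs" if "length rs = l" for b rs
  proof -
    have "diagonals rs \<le> f * l"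
      using diagonals_le[of rs] that assms by (metis le_trans mult_1 mult_le_mono1)
    moreover have "final_x b rs = real b + real (diagonals rs) - real (\<Sum>r\<leftarrow>rs. snd r)"
      by (induction rs) (auto simp: final_x_def diagonals_def)
    ultimately show ?thesis
      unfolding start_def by linarith
  qed
  have "inj_on path C"
  proof (rule inj_onI)
    fix es es' assume "path es = path es'"
    from path_of_rows_inject[OF this[unfolded path_def]] show "es = es'"
      using injD[OF inj_bump] by blast
  qed
  moreover have "path ` C = {p. backward_path f i j l p}"
  proof (intro subset_antisym subsetI)
    fix p assume "p \<in> path ` C"
    then obtain es where es: "es \<in> C" and p: "p = path es"
      by blast
    then show "p \<in> {p. backward_path f i j l p}"
      unfolding mem_Collect_eq backward_path_iff[OF assms]
      using start[of "bump es"] area_bump[OF assms, of es l] diagonals_bump[of es]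
      by (intro exI[of _ "start (bump es)"] exI[of _ "bump es"])
        (auto simp: C_def path_def diagonals_def nth_bump)
  next
    fix p assume "p \<in> {p. backward_path f i j l p}"
    then obtain b rs where p: "p = path_of_rows b rs" "length rs = l" "final_x b rs = real (f * l)"
      and i: "i = 2 * diagonals rs" and left: "\<And>s. Suc s < l \<Longrightarrow> snd (rs ! s) \<noteq> 0"
      and j: "real j = real f * (real l)\<^sup>2 +
        (\<Sum>s<l. 2 * (real s + 1) * real (snd (rs ! s)) - (2 * real s + 1) * of_bool (fst (rs ! s)))"
      unfolding mem_Collect_eq backward_path_iff[OF assms] diagonals_def by blast
    obtain es where rs: "rs = bump es"
      using ex_bump[of rs] left p(2) by blast
    have "b = start rs"
      using p start by simp
    then have "p = path es"
      by (simp add: p(1) path_def rs)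
    moreover have "es \<in> C"
      using p(2) i j area_bump[OF assms, of es l]
        by (simp add: C_def rs diagonals_bump del: of_nat_add)
    ultimately show "p \<in> path ` C"
      by blast
  qed
  ultimately have "path_count f i j l = card C"
    unfolding path_count_def by (metis card_image)
  also have "C = (if j < f * l\<^sup>2 - l then {} else codes l i (j - (f * l\<^sup>2 - l)))"
    by (auto simp: C_def codes_def)
  finally show ?thesis
    by simp
qed

lemma finite_codes: "finite (codes l i w)"
proof (rule finite_subset)
  have "snd e \<le> w" if es: "es \<in> codes l i w" and e: "e \<in> set es" for e es
  proof -
    obtain s where s: "s < length es" "e = es ! s"
      using e by (auto simp: in_set_conv_nth)
    have "snd (es ! s) \<le> 2 * Suc s * snd (es ! s) + (if fst (es ! s) then 0 else 2 * s + 1)"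
      by simp
    also have "\<dots> \<le> excess es"
      unfolding excess_def using s(1) by (intro member_le_sum) auto
    finally show ?thesis
      using es s by (simp add: codes_def)
  qed
  then show "codes l i w \<subseteq> {es. set es \<subseteq> UNIV \<times> {..w} \<and> length es = l}"
    by (force simp: codes_def)
qed (simp add: finite_lists_length_eq)

lemma diagonals_snoc: "diagonals (es @ [e]) = diagonals es + of_bool (fst e)"
  by (simp add: diagonals_def)

lemma excess_snoc:
  "excess (es @ [(d, n)]) = excess es + 2 * Suc (length es) * n +
    (if d then 0 else 2 * length es + 1)"
  by (simp add: excess_def nth_append)

text \<open>Classification by the last row. If it has a left step, removing that step keeps the number
  of rows; so the generating function for \<open>l + 1\<close> occurs on both sides, which is the origin of
  the denominators \<open>1 - q ^ (2 * l + 2)\<close>. Otherwise the row is removed altogether.\<close>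

lemma codes_Suc:
  "codes (Suc l) i w =
    (if w < 2 * Suc l then {} else (\<lambda>es. butlast es @ [apsnd Suc (last es)]) ` codes (Suc l) i (w
      - 2 * Suc l)) \<union>
    (if i < 2 then {} else (\<lambda>es. es @ [(True, 0)]) ` codes l (i - 2) w) \<union>
    (if w < 2 * l + 1 then {} else (\<lambda>es. es @ [(False, 0)]) ` codes l i (w - (2 * l + 1)))"
    (is "_ = ?A \<union> ?B \<union> ?C")
proof (intro subset_antisym subsetI)
  fix es assume es: "es \<in> codes (Suc l) i w"
  then have "es \<noteq> []"
    by (auto simp: codes_def)
  then obtain es' d n where "es = es' @ [(d, n)]"
    by (metis append_butlast_last_id surj_pair)
  note eq = this
  have prem: "length es' = l" "2 * (diagonals es' + of_bool d) = i"
      "excess es' + 2 * Suc l * n + (if d then 0 else 2 * l + 1) = w"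
    using es by (auto simp: codes_def eq diagonals_snoc excess_snoc)
  show "es \<in> ?A \<union> ?B \<union> ?C"
  proof (cases n)
    case 0
    show ?thesis
    proof (cases d)
      case True
      then have "es' \<in> codes l (i - 2) w" "\<not> i < 2"
        using prem 0 by (auto simp: codes_def)
      then show ?thesis
        using True 0 eq by auto
    next
      case False
      then have "es' \<in> codes l i (w - (2 * l + 1))" "\<not> w < 2 * l + 1"
        using prem 0 by (auto simp: codes_def)
      then show ?thesis
        using False 0 eq by auto
    qed
  next
    case (Suc m)
    have "es' @ [(d, m)] \<in> codes (Suc l) i (w - 2 * Suc l)" "\<not> w < 2 * Suc l"
      using prem Suc by (auto simp: codes_def diagonals_snoc excess_snoc)
    moreover have "es = (\<lambda>es. butlast es @ [apsnd Suc (last es)]) (es' @ [(d, m)])"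
      using eq Suc by simp
    ultimately have "es \<in> ?A"
      by (simp only: if_False) (rule image_eqI, rule refl, assumption)
    then show ?thesis
      by blast
  qed
next
  fix es assume "es \<in> ?A \<union> ?B \<union> ?C"
  then consider "es \<in> ?A" | "es \<in> ?B" | "es \<in> ?C"
    by blast
  then show "es \<in> codes (Suc l) i w"
  proof cases
    case 1
    then obtain es' where es': "es' \<in> codes (Suc l) i (w - 2 * Suc l)" "\<not> w < 2 * Suc l"
      "es = butlast es' @ [apsnd Suc (last es')]"
      by (auto split: if_splits)
    then have "es' \<noteq> []"
      by (auto simp: codes_def)
    then obtain es'' d n where "es' = es'' @ [(d, n)]"
      by (metis append_butlast_last_id surj_pair)
    with es' show ?thesis
      by (auto simp: codes_def diagonals_snoc excess_snoc)
  next
    case 2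
    then show ?thesis
      by (auto simp: codes_def diagonals_snoc excess_snoc split: if_splits)
  next
    case 3
    then show ?thesis
      by (auto simp: codes_def diagonals_snoc excess_snoc split: if_splits)
  qed
qed

lemma card_codes_Suc:
  "card (codes (Suc l) i w) =
    (if w < 2 * Suc l then 0 else card (codes (Suc l) i (w - 2 * Suc l))) +
    (if i < 2 then 0 else card (codes l (i - 2) w)) +
    (if w < 2 * l + 1 then 0 else card (codes l i (w - (2 * l + 1))))"
proof -
  let ?inc = "\<lambda>es :: (bool \<times> nat) list. butlast es @ [apsnd Suc (last es)]"
  let ?A = "if w < 2 * Suc l then {} else ?inc ` codes (Suc l) i (w - 2 * Suc l)"
  let ?B = "if i < 2 then {} else (\<lambda>es. es @ [(True, 0)]) ` codes l (i - 2) w"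
  let ?C = "if w < 2 * l + 1 then {} else (\<lambda>es. es @ [(False, 0)]) ` codes l i (w - (2 * l + 1))"
  have inc: "inj_on ?inc (codes (Suc l) i w')" for w'
  proof (rule inj_onI)
    fix es es' assume *: "es \<in> codes (Suc l) i w'" "es' \<in> codes (Suc l) i w'" "?inc es = ?inc es'"
    then have "es \<noteq> []" "es' \<noteq> []"
      by (auto simp: codes_def)
    moreover have "butlast es = butlast es'" "last es = last es'"
      using *(3) by (auto simp: apsnd_def prod_eq_iff)
    ultimately show "es = es'"
      by (metis append_butlast_last_id)
  qed
  have snoc: "inj_on (\<lambda>es. es @ [e]) X" for e :: "bool \<times> nat" and X
    by (auto intro: inj_onI)
  have "?A \<inter> ?B = {}" "(?A \<union> ?B) \<inter> ?C = {}"
    by (auto simp: apsnd_def prod_eq_iff)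
  moreover have "finite ?A" "finite ?B" "finite ?C"
    by (auto simp: finite_codes)
  ultimately have "card (?A \<union> ?B \<union> ?C) = card ?A + card ?B + card ?C"
    by (simp only: card_Un_disjoint finite_Un)
  then show ?thesis
    unfolding codes_Suc[of l i w] using card_image[OF inc] card_image[OF snoc]
      by (simp only: if_distrib[of card] card.empty)
qed

definition codes_gf :: "nat \<Rightarrow> complex fps fps" where
  "codes_gf l = Abs_fps (\<lambda>w. Abs_fps (\<lambda>i. of_nat (card (codes l i w))))"

lemma codes_gf_0: "codes_gf 0 = 1"
proof (rule fps_ext, rule fps_ext)
  fix w i
  have "codes 0 i w = (if i = 0 \<and> w = 0 then {[]} else {})"
    by (auto simp: codes_def diagonals_def excess_def)
  then show "fps_nth (fps_nth (codes_gf 0) w) i = fps_nth (fps_nth 1 w) i"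
    by (simp add: codes_gf_def)
qed

text \<open>The generating function form of \<open>codes_Suc\<close>; the outer variable is \<open>q\<close> and the inner one
  is \<open>a\<close>.\<close>

lemma codes_gf_Suc:
  "codes_gf (Suc l) * (1 - fps_X ^ (2 * Suc l)) =
    codes_gf l * (fps_const (fps_X ^ 2) + fps_X ^ (2 * l + 1))"
proof -
  have "codes_gf (Suc l) = fps_X ^ (2 * Suc l) * codes_gf (Suc l) +
    fps_const (fps_X ^ 2) * codes_gf l +
      fps_X ^ (2 * l + 1) * codes_gf l"
  proof (rule fps_ext, rule fps_ext)
    fix w i
    show "fps_nth (fps_nth (codes_gf (Suc l)) w) i =
        fps_nth (fps_nth (fps_X ^ (2 * Suc l) * codes_gf (Suc l) +
          fps_const (fps_X ^ 2) * codes_gf l +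
          fps_X ^ (2 * l + 1) * codes_gf l) w) i"
      unfolding fps_add_nth fps_X_power_mult_nth fps_mult_left_const_nth
      by (simp add: codes_gf_def card_codes_Suc[of l i w] del: mult_Suc_right power_Suc)
  qed
  then show ?thesis
    by (simp add: algebra_simps)
qed

lemma path_gf_nth:
  assumes "f \<ge> 1"
  shows "fps_nth (path_gf f) l = fps_X ^ (f * l\<^sup>2 - l) * codes_gf l"
  by (rule fps_ext, rule fps_ext)
    (simp add: path_gf_def fps_X_power_mult_nth path_count_eq[OF assms] codes_gf_def)


section \<open>Comparison of the two recursions\<close>

text \<open>The ring homomorphism underlying \<open>embed\<close>, which acts on a single coefficient of \<open>x ^ l\<close>.\<close>

definition embed_coeff :: "complex fps fps \<Rightarrow> complex fls fls" where
  "embed_coeff F = fls_compose_power (fps_to_fls (Abs_fps (\<lambda>j. fps_to_fls (fps_nth F j)))) 2"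

lemma embed_nth: "fps_nth (embed F) l = embed_coeff (fps_nth F l)"
  by (simp add: embed_def embed_coeff_def)

lemma fps_to_fls_sum: "fps_to_fls (\<Sum>i\<in>A. g i) = (\<Sum>i\<in>A. fps_to_fls (g i))"
  by (induction A rule: infinite_finite_induct) auto

lemma embed_coeff_mult: "embed_coeff (F * G) = embed_coeff F * embed_coeff G"
proof -
  have "Abs_fps (\<lambda>j. fps_to_fls (fps_nth (F * G) j)) =
      Abs_fps (\<lambda>j. fps_to_fls (fps_nth F j)) * Abs_fps (\<lambda>j. fps_to_fls (fps_nth G j))"
    by (rule fps_ext) (simp add: fps_mult_nth fps_to_fls_sum fls_times_fps_to_fls)
  then show ?thesis
    by (simp add: embed_coeff_def fls_times_fps_to_fls)
qed

lemma embed_coeff_add: "embed_coeff (F + G) = embed_coeff F + embed_coeff G"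
proof -
  have "Abs_fps (\<lambda>j. fps_to_fls (fps_nth (F + G) j)) =
      Abs_fps (\<lambda>j. fps_to_fls (fps_nth F j)) + Abs_fps (\<lambda>j. fps_to_fls (fps_nth G j))"
    by (rule fps_ext) simp
  then show ?thesis
    by (simp add: embed_coeff_def)
qed

lemma embed_coeff_const: "embed_coeff (fps_const c) = fls_const (fps_to_fls c)"
proof -
  have "Abs_fps (\<lambda>j. fps_to_fls (fps_nth (fps_const c) j)) = fps_const (fps_to_fls c)"
    by (rule fps_ext) simp
  then show ?thesis
    by (simp add: embed_coeff_def)
qed

lemma embed_coeff_1: "embed_coeff 1 = 1"
  using embed_coeff_const[of 1] by simp

lemma embed_coeff_X: "embed_coeff fps_X = var_q"
proof -
  have "Abs_fps (\<lambda>j. fps_to_fls (fps_nth fps_X j)) = (fps_X :: complex fls fps)"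
    by (rule fps_ext) (simp add: fps_X_def)
  then show ?thesis
    unfolding embed_coeff_def by (simp only:) (simp add: var_q_def fls_X_power_conv_shift_1)
qed

lemma embed_coeff_power: "embed_coeff (F ^ n) = embed_coeff F ^ n"
  by (induction n) (simp_all add: embed_coeff_1 embed_coeff_mult)

lemma embed_coeff_a: "embed_coeff (fps_const (fps_X ^ 2)) = var_a ^ 2"
  by (simp add: embed_coeff_const var_a_def fps_to_fls_power fls_const_power)

lemma var_q_power_neq_1: "n > 0 \<Longrightarrow> var_q ^ n \<noteq> 1"
proof
  assume "n > 0" "var_q ^ n = 1"
  then have "fls_subdegree (var_q ^ n) = 0"
    by simp
  with \<open>n > 0\<close> show False
    by (simp add: var_q_def flip: power_mult)
qed

lemma var_q_neq_0: "var_q \<noteq> 0"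
  by (simp add: var_q_def)

lemma var_a_neq_0: "var_a \<noteq> 0"
  by (simp add: var_a_def)

text \<open>Both sides are \<open>1\<close> for \<open>l = 0\<close> and satisfy
  \<open>c (l + 1) * (1 - q ^ (2 * l + 2)) = c l * (a\<^sup>2 + q ^ (2 * l + 1))\<close>. On the right this is
  \<open>schur_row_t_star_rec\<close> with \<open>T = 1 / q\<close>, multiplied by \<open>(- N) ^ (l + 1) * q ^ (l + 1)\<close>. Only
  \<open>N\<^sup>2\<close> enters, so the choice of the square root of \<open>\<nu>\<close> does not matter.\<close>

lemma embed_codes_gf:
  assumes N: "N ^ 2 = - (var_a ^ 2) / var_q"
  shows "embed_coeff (codes_gf l) = (- N) ^ l * schur_row (t_star N (inverse var_q)) (int l)"
proof (induction l)
  case 0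
  show ?case
    by (simp add: codes_gf_0 embed_coeff_1 schur_row_0)
next
  case (Suc l)
  let ?q = "var_q"
  let ?e = "\<lambda>l. schur_row (t_star N (inverse ?q)) (int l)"
  have q: "?q \<noteq> 0"
    by (rule var_q_neq_0)
  have "N ^ 2 \<noteq> 0"
    unfolding N using var_a_neq_0 q by simp
  then have "N \<noteq> 0"
    by auto
  have T: "inverse ?q ^ i \<noteq> inverse (inverse ?q) ^ i" if "i > 0" for i
  proof
    assume "inverse ?q ^ i = inverse (inverse ?q) ^ i"
    then have "?q ^ (i + i) = 1"
      using q by (simp add: power_add field_simps)
    then show False
      using var_q_power_neq_1[of "i + i"] that by simp
  qed
  have "1 - ?q ^ (2 * Suc l) \<noteq> 0"
    using var_q_power_neq_1[of "2 * Suc l"] by simp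
  moreover have "(1 - ?q ^ (2 * Suc l)) * embed_coeff (codes_gf (Suc l)) =
      (1 - ?q ^ (2 * Suc l)) * ((- N) ^ Suc l * ?e (Suc l))"
  proof -
    have "(1 - ?q ^ (2 * Suc l)) * embed_coeff (codes_gf (Suc l)) =
        (var_a ^ 2 + ?q ^ (2 * l + 1)) * embed_coeff (codes_gf l)"
    proof -
      have "codes_gf (Suc l) = fps_X ^ (2 * Suc l) * codes_gf (Suc l) +
          codes_gf l * (fps_const (fps_X ^ 2) + fps_X ^ (2 * l + 1))"
        using codes_gf_Suc[of l] by (simp add: algebra_simps)
      from arg_cong[OF this, of embed_coeff]
      have "embed_coeff (codes_gf (Suc l)) = ?q ^ (2 * Suc l) * embed_coeff (codes_gf (Suc l)) +
          embed_coeff (codes_gf l) * (var_a ^ 2 + ?q ^ (2 * l + 1))"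
        unfolding embed_coeff_add embed_coeff_mult embed_coeff_power embed_coeff_X embed_coeff_a .
      from trans[OF this add.commute] show ?thesis
        unfolding left_diff_distrib[of 1] mult_1 diff_eq_eq by (simp only: mult.commute)
    qed
    also have "\<dots> = (var_a ^ 2 + ?q ^ (2 * l + 1)) * (- N) ^ l * ?e l"
      by (simp only: Suc.IH mult.assoc)
    also have "var_a ^ 2 = - ?q * N ^ 2"
      using q by (simp add: N)
    also have "- ?q * N ^ 2 + ?q ^ (2 * l + 1) =
      (- N) * ?q ^ Suc l * (N * inverse ?q ^ l - inverse N * ?q ^ l)"
      using q \<open>N \<noteq> 0\<close> by (simp add: field_simps power_add power2_eq_square mult_2 mult_2_right)
    also have "\<dots> * (- N) ^ l * ?e l = (- N) ^ Suc l * ?q ^ Suc l * ((N * inverse ?q ^ l -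
      inverse N * ?q ^ l) * ?e l)"
      by simp
    also have "(N * inverse ?q ^ l - inverse N * ?q ^ l) * ?e l =
      (inverse ?q ^ Suc l - ?q ^ Suc l) * ?e (Suc l)"
      using schur_row_t_star_rec[of "inverse ?q" l N, OF T] by simp
    also have "(- N) ^ Suc l * ?q ^ Suc l * ((inverse ?q ^ Suc l - ?q ^ Suc l) * ?e (Suc l)) =
        (?q ^ Suc l * (inverse ?q ^ Suc l - ?q ^ Suc l)) * ((- N) ^ Suc l * ?e (Suc l))"
      by (simp only: mult_ac)
    also have "?q ^ Suc l * (inverse ?q ^ Suc l - ?q ^ Suc l) = 1 - ?q ^ (2 * Suc l)"
    proof -
      have "?q ^ Suc l * inverse ?q ^ Suc l = 1"
        by (subst power_mult_distrib[symmetric]) (use q in simp)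
      then show ?thesis
        by (simp only: right_diff_distrib mult_2 power_add)
    qed
    finally show ?thesis .
  qed
  ultimately show ?case
    by (simp only: mult_cancel_left) simp
qed

theorem proposition1p2:
  fixes f :: nat and nu_half :: "complex fls fls"
  assumes "f \<ge> 1"
    and "nu_half ^ 2 = - (var_a ^ 2) / var_q"
  shows "embed (path_gf f) =
    fps_compose (wave_function 1 (int f) nu_half (inverse var_q))
      (fps_const (- (nu_half * var_q ^ (f - 1))) * fps_X)"
proof (rule fps_ext)
  fix l
  have "int l * (int l - 1) * int f = int (f * (l * (l - 1)))"
    by (cases l) (simp_all add: algebra_simps)
  then have framing: "inverse var_q powi (- (int l * (int l - 1)) * int f) =
    var_q ^ (f * (l * (l - 1)))"
    by (simp add: power_int_minus power_inverse del: of_nat_mult)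
  \<comment> \<open>The factor \<open>q ^ (f - 1)\<close> in the substituted argument and the framing factor make up the
    exponent of the minimal area.\<close>
  have exponent: "f * l\<^sup>2 - l = (f - 1) * l + f * (l * (l - 1))"
  proof (cases l)
    case (Suc m)
    obtain g where "f = Suc g"
      using assms(1) by (cases f) auto
    then show ?thesis
      by (simp add: Suc power2_eq_square algebra_simps)
  qed simp
  have "fps_nth (embed (path_gf f)) l = var_q ^ (f * l\<^sup>2 - l) * embed_coeff (codes_gf l)"
    by (simp add: embed_nth path_gf_nth[OF assms(1)] embed_coeff_mult embed_coeff_power
      embed_coeff_X)
  also have "\<dots> = (- (nu_half * var_q ^ (f - 1))) ^ l *
      (var_q ^ (f * (l * (l - 1))) * schur_row (t_star nu_half (inverse var_q)) (int l))"
    unfolding embed_codes_gf[OF assms(2)] exponent minus_mult_left power_mult_distrib power_add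
      power_mult
    by (simp only: mult_ac)
  also have "\<dots> = fps_nth (fps_compose (wave_function 1 (int f) nu_half (inverse var_q))
      (fps_const (- (nu_half * var_q ^ (f - 1))) * fps_X)) l"
    unfolding wave_function_one fps_compose_linear fps_nth_Abs_fps framing ..
  finally show "fps_nth (embed (path_gf f)) l =
    fps_nth (fps_compose (wave_function 1 (int f) nu_half (inverse var_q))
      (fps_const (- (nu_half * var_q ^ (f - 1))) * fps_X)) l" .
qed


end
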